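(* Fix a difference equation $\pmb\omega=(1/f,q,w)$. Let $$\mathbf{A}(a_{11},b_{22}):=\left [\begin{array} {cccc}a_{11}&-1&0&\bar{z}\\ z&0&-1&b_{22}\end{array} \right ]\in \mathcal{O}_{2,3}^{\mathbb{C}},$$ where $z\neq0$, and let $$\mathbf{S}_5:=\left [\begin{array} {cccc}1&0&0&0\\ 0&0&-1&b_{22}\end{array} \right ],\qquad \mathbf{S}_6:=\left [\begin{array} {cccc}a_{11}&-1&0&0\\ 0&0&0&1\end{array} \right ].$$ Then $(\pmb\omega,\mathbf{A}(a_{11},b_{22}))$ has exactly $N$ eigenvalues if $ b_{22}(a_{11}+f_0)\neq|z|^2$, and exactly $N-1$ eigenvalues if $ b_{22}(a_{11}+f_0)=|z|^2$; $(\pmb\omega,\mathbf{S}_5)$ has exactly $N$ eigenvalues if $ b_{22}\neq0$, and exactly $N-1$ eigenvalues if $ b_{22}=0$; $(\pmb\omega,\mathbf{S}_6)$ has exactly $N$ eigenvalues if $ a_{11}+f_0\neq0$, and exactly $N-1$ eigenvalues if $ a_{11}+f_0=0$. Further: (i) if $b_{22}=0$, then for any $a_{11}^{(1)}< a_{11}^{(2)}$, the eigenvalues $\lambda_n(a_{11}^{(i)})$ of $(\pmb\omega, \mathbf{A}(a_{11}^{(i)},b_{22}))$, $i=1,2$, and $\lambda_n(\mathbf{S}_5)$ of $(\pmb\omega,\mathbf{S}_5)$ satisfy $$( * )\quad \lambda_0(a_{11}^{(1)})\leq\lambda_0(a_{11}^{(2)})\leq\lambda_0(\mathbf{S}_5)\leq\lambda_1(a_{11}^{(1)})\leq\lambda_1(a_{11}^{(2)})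 \leq\lambda_1(\mathbf{S}_5)\leq\cdots\leq \lambda_{N-2}(a_{11}^{(1)})\leq\lambda_{N-2}(a_{11}^{(2)})\leq\lambda_{N-2}(\mathbf{S}_5)\leq\lambda_{N-1}(a_{11}^{(1)})\leq\lambda_{N-1}(a_{11}^{(2)});$$ (ii) if $b_{22}\neq0$, then for any $a_{11}^{(1)}<a_{11}^{(2)}\leq|z|^2/b_{22}-f_0<a_{11}^{(3)}<a_{11}^{(4)}$, the eigenvalues $\lambda_n(a_{11}^{(i)})$ of $(\pmb\omega, \mathbf{A}(a_{11}^{(i)},b_{22}))$, $i=1,\dots,4$, and $\lambda_n(\mathbf{S}_5)$ satisfy $$( ** )\quad \lambda_0(a_{11}^{(3)})\leq \lambda_0(a_{11}^{(4)})\leq\lambda_0(\mathbf{S}_5)\leq\lambda_0(a_{11}^{(1)})\leq\lambda_0(a_{11}^{(2)})\leq \lambda_1(a_{11}^{(3)})\leq\lambda_1(a_{11}^{(4)}) \leq\lambda_1(\mathbf{S}_5)\leq\lambda_1(a_{11}^{(1)})\leq \lambda_1(a_{11}^{(2)}) \leq\cdots\leq\lambda_{N-2}(a_{11}^{(3)})\leq \lambda_{N-2}(a_{11}^{(4)})\leq\lambda_{N-2}(\mathbf{S}_5)\leq\lambda_{N-2}(a_{11}^{(1)})\leq\lambda_{N-2}(a_{11}^{(2)})\leq \lambda_{N-1}(a_{11}^{(3)})\leq\lambda_{N-1}(a_{11}^{(4)})\leq\lambda_{N-1}(\mathbf{S}_5)\leq\lambda_{N-1}(a_{11}^{(1)}),$$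 and in addition $\lambda_{N-1}(a_{11}^{(1)})\leq\lambda_{N-1}(a_{11}^{(2)})$ if $a_{11}^{(2)}<|z|^2/b_{22}-f_0$; (iii) if $a_{11}+f_0=0$, then for any $b_{22}^{(1)}< b_{22}^{(2)}$, the eigenvalues $\lambda_n(b_{22}^{(i)})$ of $(\pmb\omega, \mathbf{A}(a_{11},b_{22}^{(i)}))$ and $\lambda_n(\mathbf{S}_6)$ of $(\pmb\omega,\mathbf{S}_6)$ satisfy $( * )$ with $a_{11}^{(i)}$ and $\mathbf{S}_5$ replaced by $b_{22}^{(i)}$ and $\mathbf{S}_6$, $i=1,2$; (iv) if $a_{11}+f_0\neq0$, then for any $b_{22}^{(1)}<b_{22}^{(2)}\leq|z|^2/(a_{11}+f_0)<b_{22}^{(3)}<b_{22}^{(4)}$, the eigenvalues $\lambda_n(b_{22}^{(i)})$ of $(\pmb\omega, \mathbf{A}(a_{11},b_{22}^{(i)}))$ and $\lambda_n(\mathbf{S}_6)$ satisfy $( ** )$ with $a_{11}^{(i)}$ and $\mathbf{S}_5$ replaced by $b_{22}^{(i)}$ and $\mathbf{S}_6$, $i=1,\dots,4$, and in addition $\lambda_{N-1}(b_{22}^{(1)})\leq\lambda_{N-1}(b_{22}^{(2)})$ if $b_{22}^{(2)}<|z|^2/(a_{11}+f_0)$.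
   Context: Discrete Sturm–Liouville problem: equation $-\nabla(f_n\Delta y_n)+q_ny_n=\lambda w_ny_n$, $n\in[1,N]$, $N\ge2$, with real $f_n\neq0$ ($0\le n\le N$), real $q_n$, $w_n>0$ ($1\le n\le N$), abbreviated $\pmb\omega=(1/f,q,w)$; boundary condition $A(y_0, f_0\Delta y_0)^T+B(y_N,f_N\Delta y_N)^T=0$ with $\operatorname{rank}(A,B)=2$, denoted $[A\,|\,B]$ (an equivalence class modulo left multiplication by invertible $2\times2$ matrices), self-adjoint: $AJA^*=BJB^*$, $J=\begin{pmatrix}0&1\\-1&0\end{pmatrix}$. $\mathcal{O}_{2,3}^{\mathbb{C}}$ is the set of BCs $\left[\begin{smallmatrix}a_{11}&-1&0&\bar z\\ z&0&-1&b_{22}\end{smallmatrix}\right]$ with $a_{11},b_{22}\in\mathbb{R}$, $z\in\mathbb{C}$. All eigenvalues are real, counted with multiplicity and listed non-decreasingly $\lambda_0\le\lambda_1\le\cdots$. *)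

theory Defs
  imports "HOL-Analysis.Analysis" "HOL-Library.Multiset" "HOL-Library.Function_Algebras"
begin

text \<open>Discrete Sturm--Liouville problem
  -nabla(f_n Delta y_n) + q_n y_n = lambda w_n y_n, n in [1,N],
  with Delta y_n = y_(n+1) - y_n and nabla u_n = u_n - u_(n-1).
  A solution is a complex sequence y_0,...,y_(N+1); we represent it as a function
  nat => complex vanishing beyond N+1.
  A boundary condition [A|B] is represented by a 2x4 complex matrix M (rows 0,1; columns 0..3),
  M = (A, B), imposing  A (y_0, f_0 Delta y_0)^T + B (y_N, f_N Delta y_N)^T = 0.\<close>

type_synonym bcmat = "nat \<Rightarrow> nat \<Rightarrow> complex"

definition bc2x4 :: "complex list \<Rightarrow> complex list \<Rightarrow> bcmat" where
  "bc2x4 r0 r1 = (\<lambda>i j. (if i = 0 then r0 else r1) ! j)"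

definition sl_eigspace ::
  "(nat \<Rightarrow> real) \<Rightarrow> (nat \<Rightarrow> real) \<Rightarrow> (nat \<Rightarrow> real) \<Rightarrow> nat \<Rightarrow> bcmat \<Rightarrow> complex \<Rightarrow> (nat \<Rightarrow> complex) set"
  where
  "sl_eigspace f q w N M lam =
     {y. (\<forall>n. N + 1 < n \<longrightarrow> y n = 0)
       \<and> (\<forall>n\<in>{1..N}.
            - (of_real (f n) * (y (n+1) - y n) - of_real (f (n-1)) * (y n - y (n-1)))
            + of_real (q n) * y n = lam * of_real (w n) * y n)
       \<and> (\<forall>i<2. M i 0 * y 0 + M i 1 * (of_real (f 0) * (y 1 - y 0))
               + M i 2 * y N + M i 3 * (of_real (f N) * (y (N+1) - y N)) = 0)}"

definition sl_is_eigenvalue ::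
  "(nat \<Rightarrow> real) \<Rightarrow> (nat \<Rightarrow> real) \<Rightarrow> (nat \<Rightarrow> real) \<Rightarrow> nat \<Rightarrow> bcmat \<Rightarrow> complex \<Rightarrow> bool" where
  "sl_is_eigenvalue f q w N M lam \<longleftrightarrow> (\<exists>y\<in>sl_eigspace f q w N M lam. y \<noteq> 0)"

definition sl_mult ::
  "(nat \<Rightarrow> real) \<Rightarrow> (nat \<Rightarrow> real) \<Rightarrow> (nat \<Rightarrow> real) \<Rightarrow> nat \<Rightarrow> bcmat \<Rightarrow> complex \<Rightarrow> nat" where
  "sl_mult f q w N M lam =
     vector_space.dim (\<lambda>(c::complex) (y::nat \<Rightarrow> complex). (\<lambda>n. c * y n)) (sl_eigspace f q w N M lam)"

definition sl_num ::
  "(nat \<Rightarrow> real) \<Rightarrow> (nat \<Rightarrow> real) \<Rightarrow> (nat \<Rightarrow> real) \<Rightarrow> nat \<Rightarrow> bcmat \<Rightarrow> nat" where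
  "sl_num f q w N M = (\<Sum>lam\<in>{lam. sl_is_eigenvalue f q w N M lam}. sl_mult f q w N M lam)"

text \<open>The eigenvalues (all real for self-adjoint BCs) counted with multiplicity, as a multiset,
  and the n-th one in non-decreasing order (lambda_0 <= lambda_1 <= ...).\<close>
definition sl_eig_mset ::
  "(nat \<Rightarrow> real) \<Rightarrow> (nat \<Rightarrow> real) \<Rightarrow> (nat \<Rightarrow> real) \<Rightarrow> nat \<Rightarrow> bcmat \<Rightarrow> real multiset" where
  "sl_eig_mset f q w N M =
     (\<Sum>lam\<in>{lam. sl_is_eigenvalue f q w N M lam}. replicate_mset (sl_mult f q w N M lam) (Re lam))"

definition sl_ev ::
  "(nat \<Rightarrow> real) \<Rightarrow> (nat \<Rightarrow> real) \<Rightarrow> (nat \<Rightarrow> real) \<Rightarrow> nat \<Rightarrow> bcmat \<Rightarrow> nat \<Rightarrow> real" where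
  "sl_ev f q w N M n = sorted_list_of_multiset (sl_eig_mset f q w N M) ! n"

definition bcA :: "complex \<Rightarrow> real \<Rightarrow> real \<Rightarrow> bcmat" where
  "bcA z a11 b22 = bc2x4 [of_real a11, -1, 0, cnj z] [z, 0, -1, of_real b22]"

definition bcS5 :: "real \<Rightarrow> bcmat" where
  "bcS5 b22 = bc2x4 [1, 0, 0, 0] [0, 0, -1, of_real b22]"

definition bcS6 :: "real \<Rightarrow> bcmat" where
  "bcS6 a11 = bc2x4 [of_real a11, -1, 0, 0] [0, 0, 0, 1]"

end

(*
  Eliminating y_0 and v = f_N (y_(N+1) - y_N) by means of the boundary condition turns each problem
  into the weak eigenvalue problem of a Hermitian form on C^N (coordinates y_1, ..., y_N, weights w),
  or on a hyperplane of C^N when the 2x2 matrix ((a11 + f_0, cnj z), (z, b22)) of the elimination is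
  singular.  Completing the square, the form of A(a11, b22) with b22 <> 0 is the form of S_5 minus
  |f_0 y_1 - (cnj z / b22) y_N|^2 / (a11 - sigma), where sigma = |z|^2 / b22 - f_0; at a11 = sigma the
  perturbation becomes the constraint that the linear functional vanishes.  For b22 = 0 it is S_5 that
  carries the constraint y_N = 0, and a11 enters through the summand (a11 / |z|^2) |y_N|^2.  The roles
  of a11 + f_0 and b22, and of S_5 and S_6, may be exchanged.  All inequalities are then instances of
  the Courant-Fischer comparison of forms differing by a rank one term or by a one-dimensional
  constraint.
*)

theory Submission
  imports Defs
begin

section \<open>Complex sequences as a vector space\<close>

text \<open>Solving the boundary condition for (y_0, v) means inverting the Hermitian matrix ((a11 +
  f_0, cnj z), (z, b22)); the boundary part of the form is minus the quadratic form of the inverse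
  at (f_0 x_1, x_N). Block inversion writes this inverse as that of one diagonal entry plus a rank
  one matrix divided by the Schur complement of the entry. For b22 the complement is a11 - sigma,
  which is why a11 enters only as the coefficient of a single square. S_5 and S_6 are the conditions
  for infinite a11 and infinite b22. The obstacle is that the problems compared have different
  numbers of eigenvalues and live on different spaces. The spectral theorem and the comparison are
  therefore proved for forms on subspaces of the sequence space, with the eigenvalue equation tested
  against the subspace only, so that a hyperplane needs no coordinates of its own. Solutions also
  carry the boundary values y_0 and y_(N+1); restriction to 1..N loses nothing because f_0 and f_N
  are nonzero.\<close>

definition cscale :: "complex \<Rightarrow> (nat \<Rightarrow> complex) \<Rightarrow> nat \<Rightarrow> complex" where
  "cscale a x = (\<lambda>n. a * x n)"

lemma cscale_apply [simp]: "cscale a x n = a * x n"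
  by (simp add: cscale_def)

interpretation cseq: vector_space cscale
  by standard (auto simp: fun_eq_iff algebra_simps)

lemma sum_seq_apply: "(\<Sum>i\<in>I. g i) n = (\<Sum>i\<in>I. (g i :: nat \<Rightarrow> complex) n)"
  by (induction I rule: infinite_finite_induct) auto

text \<open>Bases arise below as indexed families, while independence and dimension are notions for
  sets. Two equal members would give the relation \<open>b i - b j = 0\<close>, so an independent
  family is injective.\<close>

lemma cseq_indexed_basis:
  assumes fin: "finite I"
    and ind: "\<And>c. (\<Sum>i\<in>I. cscale (c i) (b i)) = 0 \<Longrightarrow> \<forall>i\<in>I. c i = 0"
  shows "inj_on b I" and "cseq.independent (b ` I)"
proof -
  show inj: "inj_on b I"
  proof (rule inj_onI, rule ccontr)
    fix i j assume ij: "i \<in> I" "j \<in> I" "b i = b j" "i \<noteq> j"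
    let ?c = "\<lambda>k. if k = i then 1 else if k = j then -1 else (0::complex)"
    have "(\<Sum>k\<in>I. cscale (?c k) (b k)) = (\<Sum>k\<in>{i,j}. cscale (?c k) (b k))"
      using ij fin by (intro sum.mono_neutral_right) (auto simp: fun_eq_iff)
    also have "\<dots> = 0" using ij by (auto simp: fun_eq_iff)
    finally show False using ind[of ?c] ij by auto
  qed
  show "cseq.independent (b ` I)"
  proof
    assume "cseq.dependent (b ` I)"
    then obtain u where u: "\<exists>v\<in>b ` I. u v \<noteq> 0" "(\<Sum>v\<in>b ` I. cscale (u v) v) = 0"
      using cseq.dependent_finite[of "b ` I"] fin by auto
    have "(\<Sum>i\<in>I. cscale (u (b i)) (b i)) = 0"
      using u(2) by (simp add: sum.reindex[OF inj])
    from ind[OF this] show False using u(1) by auto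
  qed
qed

lemma cseq_dim_indexed_basis:
  assumes fin: "finite I" and mem: "\<And>i. i \<in> I \<Longrightarrow> b i \<in> S"
    and span: "\<And>x. x \<in> S \<Longrightarrow> \<exists>c. x = (\<Sum>i\<in>I. cscale (c i) (b i))"
    and ind: "\<And>c. (\<Sum>i\<in>I. cscale (c i) (b i)) = 0 \<Longrightarrow> \<forall>i\<in>I. c i = 0"
  shows "cseq.dim S = card I"
proof (rule cseq.dim_unique)
  show "b ` I \<subseteq> S" using mem by auto
  show "S \<subseteq> cseq.span (b ` I)"
  proof
    fix x assume "x \<in> S"
    then obtain c where "x = (\<Sum>i\<in>I. cscale (c i) (b i))" using span by auto
    moreover have "\<dots> \<in> cseq.span (b ` I)"
      by (intro cseq.span_sum cseq.span_scale cseq.span_base imageI)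
    ultimately show "x \<in> cseq.span (b ` I)" by simp
  qed
  show "cseq.independent (b ` I)" "card (b ` I) = card I"
    using cseq_indexed_basis[OF fin ind] by (auto simp: card_image)
qed

text \<open>Gaussian elimination: equation \<open>k\<close> is solved for an unknown
  \<open>i0\<close> with nonzero pivot, which leaves \<open>k\<close> equations in one unknown
  fewer.\<close>

lemma homogeneous_system_nontrivial:
  fixes a :: "nat \<Rightarrow> 'i \<Rightarrow> 'k::field"
  assumes "finite I" "k < card I"
  shows "\<exists>c. (\<exists>i\<in>I. c i \<noteq> 0) \<and> (\<forall>j<k. (\<Sum>i\<in>I. c i * a j i) = 0)"
  using assms
proof (induction k arbitrary: I a)
  case 0
  then have "I \<noteq> {}" by auto
  then show ?case by (auto intro!: exI[of _ "\<lambda>_. 1"])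
next
  case (Suc k)
  show ?case
  proof (cases "\<forall>i\<in>I. a k i = 0")
    case True
    from Suc.IH[OF Suc.prems(1), of a] Suc.prems(2) obtain c
      where "\<exists>i\<in>I. c i \<noteq> 0" "\<forall>j<k. (\<Sum>i\<in>I. c i * a j i) = 0" by auto
    then show ?thesis using True by (intro exI[of _ c]) (auto simp: less_Suc_eq)
  next
    case False
    then obtain i0 where i0: "i0 \<in> I" "a k i0 \<noteq> 0" by auto
    let ?I = "I - {i0}"
    have "k < card ?I" using Suc.prems i0 by auto
    from Suc.IH[OF _ this, of "\<lambda>j i. a j i - a j i0 * a k i / a k i0"] Suc.prems(1) obtain c
      where c: "\<exists>i\<in>?I. c i \<noteq> 0"
        "\<And>j. j < k \<Longrightarrow> (\<Sum>i\<in>?I. c i * (a j i - a j i0 * a k i / a k i0)) = 0" by auto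
    \<comment> \<open>The value at \<open>i0\<close> is forced by equation \<open>k\<close>; the
      other equations then reduce to the eliminated system.\<close>
    define c' where "c' = c(i0 := - (\<Sum>i\<in>?I. c i * a k i) / a k i0)"
    have S: "(\<Sum>i\<in>I. c' i * g i) = c' i0 * g i0 + (\<Sum>i\<in>?I. c i * g i)" for g
      using Suc.prems(1) i0(1) by (subst sum.remove[of _ i0]) (auto simp: c'_def intro!: sum.cong)
    have "(\<Sum>i\<in>I. c' i * a j i) = 0" if "j < Suc k" for j
    proof (cases "j = k")
      case True
      then show ?thesis using i0(2) unfolding S by (simp add: c'_def)
    next
      case False
      then have "j < k" using that by auto
      have "(\<Sum>i\<in>?I. c i * (a j i - a j i0 * a k i / a k i0))
          = (\<Sum>i\<in>?I. c i * a j i) - (\<Sum>i\<in>?I. c i * a k i) * (a j i0 / a k i0)"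
        unfolding sum_distrib_right sum_subtractf[symmetric] by (rule sum.cong) (auto simp: algebra_simps)
      with c(2)[OF \<open>j < k\<close>] show ?thesis unfolding S by (simp add: c'_def)
    qed
    moreover have "\<exists>i\<in>I. c' i \<noteq> 0" using c(1) by (auto simp: c'_def)
    ultimately show ?thesis by blast
  qed
qed

section \<open>Hermitian forms\<close>

text \<open>Forms are total on all sequences and do not depend on the subspace under study.
  Continuity refers to the product topology; it makes Rayleigh quotients attain their minima and
  orthogonality conditions closed.\<close>

definition herm_form :: "((nat \<Rightarrow> complex) \<Rightarrow> (nat \<Rightarrow> complex) \<Rightarrow> complex) \<Rightarrow> bool" where
  "herm_form h \<longleftrightarrow> (\<forall>x y c. h (x + y) c = h x c + h y c) \<and> (\<forall>a x c. h (cscale a x) c = a * h x c)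
     \<and> (\<forall>x c. h c x = cnj (h x c)) \<and> continuous_on UNIV (\<lambda>x. Re (h x x))
     \<and> (\<forall>c. continuous_on UNIV (\<lambda>x. h x c))"

context
  fixes h assumes h: "herm_form h"
begin

lemma herm_form_add: "h (x + y) c = h x c + h y c"
  and herm_form_scale: "h (cscale a x) c = a * h x c"
  and herm_form_sym: "h c x = cnj (h x c)"
  and herm_form_cont: "continuous_on UNIV (\<lambda>x. Re (h x x))"
  and herm_form_cont1: "continuous_on UNIV (\<lambda>x. h x c)"
  using h unfolding herm_form_def by blast+

lemma herm_form_add_right: "h c (x + y) = h c x + h c y"
  unfolding herm_form_sym[of c] by (simp add: herm_form_add)

lemma herm_form_scale_right: "h c (cscale a x) = cnj a * h c x"
  unfolding herm_form_sym[of c] by (simp add: herm_form_scale)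

lemma herm_form_zero: "h 0 c = 0" "h c 0 = 0"
  using herm_form_scale[of 0 0 c] herm_form_scale_right[of c 0 0] by (auto simp: cscale_def zero_fun_def)

lemma herm_form_minus: "h (x - y) c = h x c - h y c"
  using herm_form_add[of "x - y" y c] by simp

lemma herm_form_minus_right: "h c (x - y) = h c x - h c y"
  using herm_form_add_right[of c "x - y" y] by simp

lemma herm_form_sum: "h (\<Sum>i\<in>I. g i) c = (\<Sum>i\<in>I. h (g i) c)"
proof (induction I rule: infinite_finite_induct)
  case (insert i F)
  then show ?case by (simp only: sum.insert herm_form_add not_False_eq_True)
qed (simp_all only: sum.infinite sum.empty herm_form_zero not_False_eq_True)

lemma herm_form_sum_right: "h c (\<Sum>i\<in>I. g i) = (\<Sum>i\<in>I. h c (g i))"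
proof (induction I rule: infinite_finite_induct)
  case (insert i F)
  then show ?case by (simp only: sum.insert herm_form_add_right not_False_eq_True)
qed (simp_all only: sum.infinite sum.empty herm_form_zero not_False_eq_True)

lemma herm_form_diag_real: "h x x = of_real (Re (h x x))"
proof -
  have "Im (h x x) = - Im (h x x)" by (subst herm_form_sym) simp
  then show ?thesis by (simp add: complex_eq_iff)
qed

text \<open>A null vector of a positive semidefinite form lies in its radical: otherwise the form at
  \<open>b x + y\<close> is affine and nonconstant in the real factor of \<open>b\<close> and
  becomes negative.\<close>

lemma herm_form_nonneg_null:
  assumes U: "cseq.subspace U" and nn: "\<And>y. y \<in> U \<Longrightarrow> Re (h y y) \<ge> 0"
    and x: "x \<in> U" "Re (h x x) = 0" and y: "y \<in> U"
  shows "h x y = 0"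
proof (rule ccontr)
  assume ne: "h x y \<noteq> 0"
  define G where "G = (cmod (h x y))\<^sup>2"
  have Gp: "G > 0" using ne by (simp add: G_def)
  \<comment> \<open>Chosen so that \<open>2 * s * G + Re (h y y)\<close>, the value of the form at
    \<open>v\<close>, is exactly -1.\<close>
  define s where "s = - (Re (h y y) + 1) / (2 * G)"
  define b where "b = complex_of_real s * cnj (h x y)"
  define v where "v = cscale b x + y"
  have "v \<in> U" using U x(1) y unfolding v_def by (simp add: cseq.subspace_add cseq.subspace_scale)
  then have pos: "Re (h v v) \<ge> 0" by (rule nn)
  have xx: "h x x = 0" by (subst herm_form_diag_real) (simp only: x(2) of_real_0)
  have "h v v = b * h x y + cnj b * h y x + h y y"
    unfolding v_def herm_form_add herm_form_add_right herm_form_scale herm_form_scale_right xx by simp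
  also have "h y x = cnj (h x y)" by (rule herm_form_sym)
  also have "b * h x y = of_real (s * G)"
    by (simp add: b_def G_def mult.commute complex_norm_square[symmetric])
  also have "cnj b * cnj (h x y) = of_real (s * G)"
    by (simp add: b_def G_def complex_norm_square[symmetric])
  finally have "h v v = of_real (2 * s * G) + h y y" by simp
  then have "Re (h v v) = 2 * s * G + Re (h y y)" by simp
  also have "\<dots> = -1" using Gp by (simp add: s_def field_simps)
  finally show False using pos by simp
qed

end

lemma herm_form_shift:
  assumes h: "herm_form h" and p: "herm_form p"
  shows "herm_form (\<lambda>x y. h x y + of_real r * p x y)"
  unfolding herm_form_def
proof (intro conjI allI)
  show "continuous_on UNIV (\<lambda>x. Re (h x x + complex_of_real r * p x x))"
    using herm_form_cont[OF h] herm_form_cont[OF p] by (auto intro!: continuous_intros)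
  show "continuous_on UNIV (\<lambda>x. h x c + complex_of_real r * p x c)" for c
    using herm_form_cont1[OF h] herm_form_cont1[OF p] by (auto intro!: continuous_intros)
  show "h c x + complex_of_real r * p c x = cnj (h x c + complex_of_real r * p x c)" for x c
    using herm_form_sym[OF h, of c x] herm_form_sym[OF p, of c x] by simp
qed (auto simp: herm_form_add[OF h] herm_form_add[OF p] herm_form_scale[OF h] herm_form_scale[OF p] algebra_simps)

lemma herm_form_plus: "herm_form h \<Longrightarrow> herm_form p \<Longrightarrow> herm_form (\<lambda>x y. h x y + p x y)"
  using herm_form_shift[of h p 1] by simp

lemma herm_form_0: "herm_form (\<lambda>x y. 0)"
  by (simp add: herm_form_def)

lemma herm_form_setsum:
  "(\<And>i. i \<in> I \<Longrightarrow> herm_form (h i)) \<Longrightarrow> herm_form (\<lambda>x y. \<Sum>i\<in>I. h i x y)"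
  by (induction I rule: infinite_finite_induct) (simp_all add: herm_form_0 herm_form_plus)

lemma herm_form_rank_one:
  assumes "\<And>x y. L (x + y) = L x + L y" "\<And>a x. L (cscale a x) = a * L x" "continuous_on UNIV L"
  shows "herm_form (\<lambda>x y. of_real r * L x * cnj (L y))"
  unfolding herm_form_def using assms by (auto intro!: continuous_intros simp: algebra_simps)

lemma herm_form_coord: "herm_form (\<lambda>x y. of_real r * x i * cnj (y i))"
  by (rule herm_form_rank_one[of "\<lambda>x. x i"]) auto

lemma herm_form_cross: "herm_form (\<lambda>x y. C * x i * cnj (y j) + cnj C * x j * cnj (y i))"
  unfolding herm_form_def
  by (intro conjI allI continuous_intros continuous_on_product_coordinates) (auto simp: algebra_simps)

section \<open>Spectral theorem\<close>

text \<open>The instances are C^N and its hyperplanes inside the space of sequences, with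
  \<open>d\<close> the dimension of \<open>V\<close>.\<close>

locale herm_space =
  fixes V :: "(nat \<Rightarrow> complex) set" and p :: "(nat \<Rightarrow> complex) \<Rightarrow> (nat \<Rightarrow> complex) \<Rightarrow> complex" and d :: nat
  assumes sub: "cseq.subspace V"
    and herm: "herm_form p"
    and pos: "\<And>x. x \<in> V \<Longrightarrow> x \<noteq> 0 \<Longrightarrow> Re (p x x) > 0"
    and sphere: "compact {x \<in> V. Re (p x x) = 1}"
    and basis: "\<exists>B. finite B \<and> B \<subseteq> V \<and> cseq.independent B \<and> V \<subseteq> cseq.span B \<and> card B = d"
begin

lemma zero_mem: "0 \<in> V"
  and add_mem: "x \<in> V \<Longrightarrow> y \<in> V \<Longrightarrow> x + y \<in> V"
  and diff_mem: "x \<in> V \<Longrightarrow> y \<in> V \<Longrightarrow> x - y \<in> V"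
  and scale_mem: "x \<in> V \<Longrightarrow> cscale a x \<in> V"
  and sum_mem: "(\<And>i. i \<in> I \<Longrightarrow> g i \<in> V) \<Longrightarrow> sum g I \<in> V"
  using sub by (auto intro: cseq.subspace_0 cseq.subspace_add cseq.subspace_diff cseq.subspace_scale
      cseq.subspace_sum)

definition onf :: "(nat \<Rightarrow> nat \<Rightarrow> complex) \<Rightarrow> nat \<Rightarrow> bool" where
  "onf e k \<longleftrightarrow> (\<forall>i<k. e i \<in> V) \<and> (\<forall>i<k. \<forall>j<k. p (e i) (e j) = (if i = j then 1 else 0))"

lemma onf_coeff:
  assumes "onf e k" "I \<subseteq> {..<k}" "j < k"
  shows "p (\<Sum>i\<in>I. cscale (c i) (e i)) (e j) = (if j \<in> I then c j else 0)"
proof -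
  have "p (\<Sum>i\<in>I. cscale (c i) (e i)) (e j) = (\<Sum>i\<in>I. if i = j then c i else 0)"
    unfolding herm_form_sum[OF herm] herm_form_scale[OF herm]
    using assms by (intro sum.cong) (auto simp: onf_def)
  also have "\<dots> = (if j \<in> I then c j else 0)"
    using finite_subset[OF assms(2)] by simp
  finally show ?thesis .
qed

definition orth :: "(nat \<Rightarrow> nat \<Rightarrow> complex) \<Rightarrow> nat \<Rightarrow> (nat \<Rightarrow> complex) set" where
  "orth e k = {x \<in> V. \<forall>i<k. p x (e i) = 0}"

lemma orth_subspace: "cseq.subspace (orth e k)"
  by (rule cseq.subspaceI)
    (auto simp only: orth_def mem_Collect_eq zero_mem add_mem scale_mem herm_form_zero[OF herm]
      herm_form_add[OF herm] herm_form_scale[OF herm] mult_zero_right add_0_right)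

lemma orth_residual:
  assumes "onf e k" "x \<in> V"
  shows "x - (\<Sum>i<k. cscale (p x (e i)) (e i)) \<in> orth e k"
proof -
  have "(\<Sum>i<k. cscale (p x (e i)) (e i)) \<in> V"
    using assms(1) by (intro sum_mem scale_mem) (auto simp: onf_def)
  then show ?thesis
    using assms onf_coeff[OF assms(1) order_refl]
    by (auto simp only: orth_def mem_Collect_eq diff_mem herm_form_minus[OF herm] lessThan_iff if_True diff_self)
qed

text \<open>The \<open>k\<close> orthogonality conditions form a homogeneous system in the
  \<open>d\<close> coefficients over a basis.\<close>

lemma orth_nontrivial:
  assumes "k < d"
  shows "\<exists>x\<in>orth e k. x \<noteq> 0"
proof -
  obtain B where B: "finite B" "B \<subseteq> V" "cseq.independent B" "card B = d" using basis by auto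
  obtain c where c: "\<exists>b\<in>B. c b \<noteq> 0" "\<forall>j<k. (\<Sum>b\<in>B. c b * p b (e j)) = 0"
    using homogeneous_system_nontrivial[of B k "\<lambda>j b. p b (e j)"] B(1,4) assms by blast
  let ?x = "\<Sum>b\<in>B. cscale (c b) b"
  have "?x \<noteq> 0" using cseq.independentD[OF B(3) B(1) order_refl, of c] c(1) by blast
  moreover have "?x \<in> V" using B(2) by (intro sum_mem scale_mem) auto
  moreover have "p ?x (e j) = 0" if "j < k" for j
    unfolding herm_form_sum[OF herm] herm_form_scale[OF herm] using c(2) that by blast
  ultimately show ?thesis unfolding orth_def by blast
qed

text \<open>Appending a nonzero \<open>x\<close> to the family would give \<open>d + 1\<close>
  pairwise orthogonal nonzero vectors, hence independent ones, in a space spanned by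
  \<open>d\<close>.\<close>

lemma orth_trivial:
  assumes "onf e d" "x \<in> orth e d"
  shows "x = 0"
proof (rule ccontr)
  assume x0: "x \<noteq> 0"
  obtain B where B: "finite B" "V \<subseteq> cseq.span B" "card B = d" using basis by auto
  define b where "b = e(d := x)"
  have bV: "b i \<in> V" if "i \<le> d" for i using that assms by (auto simp: b_def onf_def orth_def)
  have pb: "p (b i) (b j) = 0" if "i \<le> d" "j \<le> d" "i \<noteq> j" for i j
    using that assms herm_form_sym[OF herm, of "e i" x] by (auto simp: b_def onf_def orth_def)
  have pp: "p (b i) (b i) \<noteq> 0" if "i \<le> d" for i
    using that assms pos[of x] x0 by (auto simp: b_def onf_def orth_def)
  have ind: "\<forall>i\<in>{..d}. c i = 0" if c: "(\<Sum>i\<in>{..d}. cscale (c i) (b i)) = 0" for c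
  proof
    fix j assume j: "j \<in> {..d}"
    have "0 = p (\<Sum>i\<in>{..d}. cscale (c i) (b i)) (b j)" unfolding c herm_form_zero[OF herm] ..
    also have "\<dots> = (\<Sum>i\<in>{..d}. if i = j then c j * p (b j) (b j) else 0)"
      unfolding herm_form_sum[OF herm] herm_form_scale[OF herm]
      using j by (intro sum.cong) (auto simp: pb)
    also have "\<dots> = c j * p (b j) (b j)" using j by simp
    finally show "c j = 0" using pp j by auto
  qed
  note ib = cseq_indexed_basis[of "{..d}" b, OF finite_atMost ind]
  have "card (b ` {..d}) \<le> card B"
    using cseq.independent_span_bound[OF B(1) ib(2)] bV B(2) by auto
  moreover have "card (b ` {..d}) = Suc d" using card_image[OF ib(1)] by simp
  ultimately show False using B(3) by simp
qed

lemma onf_expand: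
  assumes "onf e d" "x \<in> V"
  shows "x = (\<Sum>i<d. cscale (p x (e i)) (e i))"
  using orth_trivial[OF assms(1) orth_residual[OF assms]] by (rule eq_iff_diff_eq_0[THEN iffD2])

text \<open>The equation is tested against \<open>V\<close> only: for a hyperplane these are the
  eigenvectors of the compressed form.\<close>

definition eigen_sys :: "((nat \<Rightarrow> complex) \<Rightarrow> (nat \<Rightarrow> complex) \<Rightarrow> complex) \<Rightarrow> (nat \<Rightarrow> nat \<Rightarrow> complex)
    \<Rightarrow> (nat \<Rightarrow> real) \<Rightarrow> nat \<Rightarrow> bool" where
  "eigen_sys h e l k \<longleftrightarrow> onf e k \<and> (\<forall>i<k. \<forall>c\<in>V. h (e i) c = of_real (l i) * p (e i) c)
     \<and> (\<forall>j<k. \<forall>i\<le>j. l i \<le> l j)"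

text \<open>The unit sphere of \<open>orth e k\<close> is compact, so the form attains a minimum
  there; homogeneity carries the bound to all of \<open>orth e k\<close>.\<close>

lemma rayleigh_minimiser:
  assumes h: "herm_form h" and k: "k < d"
  shows "\<exists>x\<in>orth e k. p x x = 1 \<and> (\<forall>y\<in>orth e k. Re (h x x) * Re (p y y) \<le> Re (h y y))"
proof -
  let ?S = "{x \<in> orth e k. Re (p x x) = 1}"
  have scaled: "cscale (of_real (1 / sqrt (Re (p y y)))) y \<in> ?S \<and>
      Re (g (cscale (of_real (1 / sqrt (Re (p y y)))) y) (cscale (of_real (1 / sqrt (Re (p y y)))) y)) = Re (g y y) / Re (p y y)"
    if y: "y \<in> orth e k" "y \<noteq> 0" and g: "herm_form g" for y g
  proof -
    have pp: "Re (p y y) > 0" using y pos by (auto simp: orth_def)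
    define s where "s = complex_of_real (1 / sqrt (Re (p y y)))"
    have ss: "s * cnj s = of_real (1 / Re (p y y))"
      using pp unfolding s_def complex_cnj_complex_of_real of_real_mult[symmetric] by simp
    have gs: "Re (g' (cscale s y) (cscale s y)) = Re (g' y y) / Re (p y y)" if "herm_form g'" for g'
    proof -
      have "g' (cscale s y) (cscale s y) = (s * cnj s) * g' y y"
        unfolding herm_form_scale[OF that] herm_form_scale_right[OF that] by (simp only: mult_ac)
      then show ?thesis unfolding ss by simp
    qed
    show ?thesis using gs[OF herm] gs[OF g] pp cseq.subspace_scale[OF orth_subspace y(1), of s]
      unfolding s_def[symmetric] by auto
  qed
  have "compact ({x \<in> V. Re (p x x) = 1} \<inter> (\<Inter>i\<in>{..<k}. {x. p x (e i) = 0}))"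
    by (intro compact_Int_closed sphere closed_INT ballI closed_Collect_eq
        herm_form_cont1[OF herm] continuous_on_const)
  also have "({x \<in> V. Re (p x x) = 1} \<inter> (\<Inter>i\<in>{..<k}. {x. p x (e i) = 0})) = ?S"
    by (auto simp: orth_def)
  finally have comp: "compact ?S" .
  obtain x0 where "x0 \<in> orth e k" "x0 \<noteq> 0" using orth_nontrivial[OF k] by auto
  then have "?S \<noteq> {}" using scaled[OF _ _ h] by blast
  then obtain x where x: "x \<in> ?S" "\<And>y. y \<in> ?S \<Longrightarrow> Re (h x x) \<le> Re (h y y)"
    using continuous_attains_inf[OF comp _ continuous_on_subset[OF herm_form_cont[OF h]]] by auto
  have "Re (h x x) * Re (p y y) \<le> Re (h y y)" if y: "y \<in> orth e k" for y
  proof (cases "y = 0")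
    case True
    then show ?thesis by (simp only: herm_form_zero[OF h] herm_form_zero[OF herm] zero_complex.sel mult_zero_right order_refl)
  next
    case False
    have pp: "Re (p y y) > 0" using y False pos by (auto simp: orth_def)
    note sc = scaled[OF y False h]
    have "Re (h x x) \<le> Re (h y y) / Re (p y y)"
      using x(2)[OF conjunct1[OF sc]] unfolding conjunct2[OF sc] .
    then show ?thesis using pp by (simp add: field_simps)
  qed
  moreover have "p x x = 1" using x(1) by (subst herm_form_diag_real[OF herm]) auto
  ultimately show ?thesis using x(1) by auto
qed

text \<open>The bound on \<open>orth e k\<close> is the extra invariant of the induction: it puts
  the next minimum above all eigenvalues found so far, so the list comes out sorted.\<close>

lemma spectral_partial:
  assumes h: "herm_form h"
  shows "k \<le> d \<Longrightarrow> \<exists>e l. eigen_sys h e l k \<and>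
    (\<forall>y\<in>orth e k. \<forall>i<k. l i * Re (p y y) \<le> Re (h y y))"
proof (induction k)
  case 0
  show ?case by (auto simp: eigen_sys_def onf_def)
next
  case (Suc k)
  then obtain e l where e: "eigen_sys h e l k"
    and ext: "\<And>y i. y \<in> orth e k \<Longrightarrow> i < k \<Longrightarrow> l i * Re (p y y) \<le> Re (h y y)" by force
  have on: "onf e k" and eig: "\<And>i c. i < k \<Longrightarrow> c \<in> V \<Longrightarrow> h (e i) c = of_real (l i) * p (e i) c"
    and srt: "\<And>i j. j < k \<Longrightarrow> i \<le> j \<Longrightarrow> l i \<le> l j" using e by (auto simp: eigen_sys_def)
  obtain x where x: "x \<in> orth e k" "p x x = 1"
    and min: "\<And>y. y \<in> orth e k \<Longrightarrow> Re (h x x) * Re (p y y) \<le> Re (h y y)"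
    using rayleigh_minimiser[OF h, of k e] Suc.prems by auto
  define m where "m = Re (h x x)"
  have xV: "x \<in> V" and xe: "\<And>i. i < k \<Longrightarrow> p x (e i) = 0" using x by (auto simp: orth_def)
  have ex: "p (e i) x = 0" if "i < k" for i
    using herm_form_sym[OF herm, of "e i" x] xe[OF that] by simp
  have hx: "h x (e i) = 0" if "i < k" for i
    using herm_form_sym[OF h, of x "e i"] eig[OF that xV] ex[OF that] by simp
  let ?g = "\<lambda>x y. h x y + of_real (-m) * p x y"
  \<comment> \<open>By minimality \<open>h - m p\<close> is nonnegative on \<open>orth e k\<close>
    and vanishes at \<open>x\<close>, so \<open>x\<close> is in its radical there.\<close>
  have g0: "?g x y = 0" if "y \<in> orth e k" for y
    using herm_form_nonneg_null[OF herm_form_shift[OF h herm] orth_subspace[of e k] _ x(1) _ that, of "- m"]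
      min x(2) by (simp add: m_def)
  have eigx: "h x c = of_real m * p x c" if c: "c \<in> V" for c
  proof -
    \<comment> \<open>An arbitrary test vector is \<open>s\<close>, in the span of the earlier
      eigenvectors, plus a residual in \<open>orth e k\<close>. The residual is handled by
      \<open>g0\<close>; against \<open>s\<close> both forms vanish.\<close>
    define s where "s = (\<Sum>i<k. cscale (p c (e i)) (e i))"
    have "?g x (c - s) = 0" using g0 orth_residual[OF on c] s_def by auto
    moreover have "h x s = 0"
      unfolding s_def herm_form_sum_right[OF h] herm_form_scale_right[OF h] by (simp add: hx)
    moreover have "p x s = 0"
      unfolding s_def herm_form_sum_right[OF herm] herm_form_scale_right[OF herm] by (simp add: xe)
    ultimately show ?thesis
      unfolding herm_form_minus_right[OF h] herm_form_minus_right[OF herm] by simp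
  qed
  let ?e = "e(k := x)" and ?l = "l(k := m)"
  have "onf ?e (Suc k)" using on x xV xe ex by (auto simp: onf_def less_Suc_eq)
  moreover have "\<forall>i<Suc k. \<forall>c\<in>V. h (?e i) c = of_real (?l i) * p (?e i) c"
    using eig eigx by (auto simp: less_Suc_eq)
  moreover have "l i \<le> m" if "i < k" for i using ext[OF x(1) that] x(2) by (simp add: m_def)
  then have "\<forall>j<Suc k. \<forall>i\<le>j. ?l i \<le> ?l j" using srt by (auto simp: less_Suc_eq)
  moreover have "?l i * Re (p y y) \<le> Re (h y y)" if y: "y \<in> orth ?e (Suc k)" and i: "i < Suc k" for y i
  proof -
    have "p y (e i) = 0" if "i < k" for i
      using y that by (auto simp: orth_def dest!: spec[of _ i])
    then have "y \<in> orth e k" using y by (simp add: orth_def)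
    then show ?thesis using i min[of y] ext[of y i] by (auto simp: m_def less_Suc_eq)
  qed
  ultimately show ?case unfolding eigen_sys_def by blast
qed

lemma spectral:
  assumes "herm_form h"
  obtains e l where "eigen_sys h e l d"
  using spectral_partial[OF assms, of d] by auto

lemma eigen_sys_quadratic:
  assumes h: "herm_form h" and e: "eigen_sys h e l d" and x: "x \<in> V"
  shows "Re (p x x) = (\<Sum>i<d. (cmod (p x (e i)))\<^sup>2)"
    and "Re (h x x) = (\<Sum>i<d. l i * (cmod (p x (e i)))\<^sup>2)"
proof -
  have on: "onf e d" using e by (simp add: eigen_sys_def)
  have P: "p x c = (\<Sum>i<d. p x (e i) * p (e i) c)" for c
    by (subst onf_expand[OF on x]) (simp only: herm_form_sum[OF herm] herm_form_scale[OF herm])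
  have H: "h x c = (\<Sum>i<d. p x (e i) * h (e i) c)" for c
    by (subst onf_expand[OF on x]) (simp only: herm_form_sum[OF h] herm_form_scale[OF h])
  have ee: "p (e i) x = cnj (p x (e i))" for i by (rule herm_form_sym[OF herm])
  have he: "h (e i) x = of_real (l i) * cnj (p x (e i))" if "i < d" for i
    using e x that ee[of i] by (auto simp: eigen_sys_def)
  have "p x x = of_real (\<Sum>i<d. (cmod (p x (e i)))\<^sup>2)"
    unfolding P[of x] ee of_real_sum complex_norm_square ..
  then show "Re (p x x) = (\<Sum>i<d. (cmod (p x (e i)))\<^sup>2)" by simp
  have "h x x = of_real (\<Sum>i<d. l i * (cmod (p x (e i)))\<^sup>2)"
    unfolding H[of x] of_real_sum of_real_mult complex_norm_square
    by (intro sum.cong refl) (auto simp: he)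
  then show "Re (h x x) = (\<Sum>i<d. l i * (cmod (p x (e i)))\<^sup>2)" by simp
qed

text \<open>Eigenvectors for different values are orthogonal, so only coefficients with
  \<open>l i = lam\<close> survive. Since \<open>lam\<close> is complex, this also excludes nonreal
  eigenvalues: the sum is then empty.\<close>

lemma eigenspace_expand:
  assumes h: "herm_form h" and e: "eigen_sys h e l d" and x: "x \<in> V"
    and eig: "\<And>c. c \<in> V \<Longrightarrow> h x c = lam * p x c"
  shows "x = (\<Sum>i | i < d \<and> of_real (l i) = lam. cscale (p x (e i)) (e i))"
proof -
  have on: "onf e d" using e by (simp add: eigen_sys_def)
  have "p x (e i) = 0" if i: "i < d" "of_real (l i) \<noteq> lam" for i
  proof -
    have eV: "e i \<in> V" using on i by (auto simp: onf_def)
    have "lam * p x (e i) = h x (e i)" using eig eV by simp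
    also have "\<dots> = cnj (h (e i) x)" by (rule herm_form_sym[OF h])
    also have "h (e i) x = of_real (l i) * p (e i) x" using e i(1) x by (auto simp: eigen_sys_def)
    also have "p (e i) x = cnj (p x (e i))" by (rule herm_form_sym[OF herm])
    finally show ?thesis using i(2) by simp
  qed
  then have "(\<Sum>i<d. cscale (p x (e i)) (e i)) = (\<Sum>i | i < d \<and> of_real (l i) = lam. cscale (p x (e i)) (e i))"
    by (intro sum.mono_neutral_right) (auto simp: fun_eq_iff)
  then show ?thesis using onf_expand[OF on x] by (rule trans[rotated])
qed

end

text \<open>Courant--Fischer: a nonzero combination of the first \<open>n + k + 1\<close> eigenvectors of the second form
  meets \<open>k\<close> linear constraints and orthogonality to the first \<open>n\<close> eigenvectors of the first form.\<close>

lemma eigen_sys_compare: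
  fixes g :: "nat \<Rightarrow> (nat \<Rightarrow> complex) \<Rightarrow> complex"
  assumes V1: "herm_space V1 p d1" and V2: "herm_space V2 p d2"
    and h1: "herm_form h1" and h2: "herm_form h2"
    and e1: "herm_space.eigen_sys V1 p h1 e1 l1 d1" and e2: "herm_space.eigen_sys V2 p h2 e2 l2 d2"
    and lin: "\<And>j x y. g j (x + y) = g j x + g j y" "\<And>j a x. g j (cscale a x) = a * g j x"
    and sub: "\<And>x. x \<in> V2 \<Longrightarrow> (\<And>j. j < k \<Longrightarrow> g j x = 0) \<Longrightarrow> x \<in> V1 \<and> Re (h1 x x) \<le> Re (h2 x x)"
    and n: "n < d1" "n + k < d2"
  shows "l1 n \<le> l2 (n + k)"
proof -
  interpret A: herm_space V1 p d1 by (rule V1)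
  interpret B: herm_space V2 p d2 by (rule V2)
  have on2: "B.onf e2 d2" and on1: "A.onf e1 d1"
    using e1 e2 by (auto simp: A.eigen_sys_def B.eigen_sys_def)
  have g0: "g j 0 = 0" for j using lin(1)[of j 0 0] by simp
  have gsum: "g j (\<Sum>i\<in>I. cscale (c i) (b i)) = (\<Sum>i\<in>I. c i * g j (b i))"
    for j c b and I :: "nat set"
  proof (induction I rule: infinite_finite_induct)
    case (insert i F)
    then show ?case by (simp only: sum.insert lin not_False_eq_True)
  qed (simp_all only: sum.infinite sum.empty g0 not_False_eq_True)
  let ?I = "{..n + k}"
  \<comment> \<open>There are \<open>n + k + 1\<close> unknowns. Equations below \<open>k\<close>
    are the linear constraints, the remaining \<open>n\<close> the orthogonality to
    \<open>e1\<close>, with index shifted by \<open>k\<close>.\<close>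
  obtain c where c: "\<exists>i\<in>?I. c i \<noteq> 0"
    "\<And>j. j < n + k \<Longrightarrow> (\<Sum>i\<in>?I. c i * (if j < k then g j (e2 i) else p (e2 i) (e1 (j - k)))) = 0"
    using homogeneous_system_nontrivial[of ?I "n + k" "\<lambda>j i. if j < k then g j (e2 i) else p (e2 i) (e1 (j - k))"]
    by auto
  define x where "x = (\<Sum>i\<in>?I. cscale (c i) (e2 i))"
  have IS: "?I \<subseteq> {..<d2}" using n by auto
  have xV2: "x \<in> V2" unfolding x_def
    using on2 IS by (intro B.sum_mem B.scale_mem) (auto simp: B.onf_def)
  have co: "p x (e2 i) = (if i \<in> ?I then c i else 0)" if "i < d2" for i
    unfolding x_def by (rule B.onf_coeff[OF on2 IS that])
  have "g j x = 0" if "j < k" for j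
    using c(2)[of j] that unfolding x_def gsum by simp
  then have xV1: "x \<in> V1" and le: "Re (h1 x x) \<le> Re (h2 x x)" using sub[OF xV2] by auto
  have pe1: "p x (e1 j) = 0" if "j < n" for j
    using c(2)[of "k + j"] that
    unfolding x_def herm_form_sum[OF A.herm] herm_form_scale[OF A.herm] by simp
  have "x \<noteq> 0"
  proof
    assume "x = 0"
    then have "p x (e2 i) = 0" for i by (simp only: herm_form_zero[OF A.herm])
    then show False using c(1) co IS by (metis lessThan_iff subsetD)
  qed
  then have pp: "Re (p x x) > 0" using B.pos xV2 by auto
  have s1: "l1 n \<le> l1 i" if "n \<le> i" "i < d1" for i using e1 that by (auto simp: A.eigen_sys_def)
  have s2: "l2 i \<le> l2 (n + k)" if "i \<le> n + k" for i using e2 that n by (auto simp: B.eigen_sys_def)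
  \<comment> \<open>\<open>x\<close> has no component along \<open>e1\<close> below index
    \<open>n\<close> and none along \<open>e2\<close> above \<open>n + k\<close>, which bounds the
    two Rayleigh quotients from below and from above.\<close>
  have "l1 n * Re (p x x) \<le> Re (h1 x x)"
    unfolding A.eigen_sys_quadratic[OF h1 e1 xV1] sum_distrib_left
  proof (rule sum_mono)
    fix i assume "i \<in> {..<d1}"
    then show "l1 n * (cmod (p x (e1 i)))\<^sup>2 \<le> l1 i * (cmod (p x (e1 i)))\<^sup>2"
      using s1[of i] pe1[of i] by (cases "i < n") (auto intro!: mult_right_mono)
  qed
  also note le
  also have "Re (h2 x x) \<le> l2 (n + k) * Re (p x x)"
    unfolding B.eigen_sys_quadratic[OF h2 e2 xV2] sum_distrib_left
  proof (rule sum_mono)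
    fix i assume "i \<in> {..<d2}"
    then show "l2 i * (cmod (p x (e2 i)))\<^sup>2 \<le> l2 (n + k) * (cmod (p x (e2 i)))\<^sup>2"
      using s2[of i] co[of i] by (cases "i \<le> n + k") (auto intro!: mult_right_mono)
  qed
  finally show ?thesis using pp by simp
qed

section \<open>Sturm--Liouville forms\<close>

locale sl_equation =
  fixes f q w :: "nat \<Rightarrow> real" and N :: nat
  assumes N2: "N \<ge> 2"
    and f_nz: "\<And>n. n \<le> N \<Longrightarrow> f n \<noteq> 0"
    and w_pos: "\<And>n. 1 \<le> n \<Longrightarrow> n \<le> N \<Longrightarrow> w n > 0"
begin

definition X :: "(nat \<Rightarrow> complex) set" where
  "X = {x. \<forall>n. n \<notin> {1..N} \<longrightarrow> x n = 0}"

definition K :: "complex \<Rightarrow> complex \<Rightarrow> (nat \<Rightarrow> complex) set" where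
  "K a b = {x \<in> X. a * x 1 + b * x N = 0}"

definition p :: "(nat \<Rightarrow> complex) \<Rightarrow> (nat \<Rightarrow> complex) \<Rightarrow> complex" where
  "p x c = (\<Sum>n\<in>{1..N}. of_real (w n) * x n * cnj (c n))"

text \<open>The energy left by summation by parts. Of the boundary term
  \<open>f 0 * (y 1 - y 0) * cnj (c 1)\<close> it keeps the \<open>y 1\<close> half; the part with
  \<open>y 0\<close> is left to the boundary condition.\<close>

definition t :: "(nat \<Rightarrow> complex) \<Rightarrow> (nat \<Rightarrow> complex) \<Rightarrow> complex" where
  "t x c = (\<Sum>n\<in>{1..<N}. of_real (f n) * (x (n+1) - x n) * cnj (c (n+1) - c n))
     + of_real (f 0) * x 1 * cnj (c 1) + (\<Sum>n\<in>{1..N}. of_real (q n) * x n * cnj (c n))"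

text \<open>Elimination of the boundary values adds a Hermitian form in (x_1, x_N) to
  \<open>t\<close>; \<open>A\<close>, \<open>B\<close>, \<open>C\<close> are its matrix
  entries.\<close>

definition H :: "real \<Rightarrow> real \<Rightarrow> complex \<Rightarrow> (nat \<Rightarrow> complex) \<Rightarrow> (nat \<Rightarrow> complex) \<Rightarrow> complex" where
  "H A B C x c = t x c + of_real A * x 1 * cnj (c 1) + of_real B * x N * cnj (c N)
     + C * x 1 * cnj (c N) + cnj C * x N * cnj (c 1)"

lemma herm_p: "herm_form p"
  unfolding p_def by (intro herm_form_setsum herm_form_coord)

lemma herm_H: "herm_form (H A B C)"
proof -
  have "herm_form (\<lambda>x c. of_real (f n) * (x (n+1) - x n) * cnj (c (n+1) - c n))" for n
    by (rule herm_form_rank_one[of "\<lambda>x. x (n+1) - x n"])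
      (auto simp: algebra_simps intro!: continuous_intros)
  then have "herm_form t" unfolding t_def
    by (intro herm_form_plus herm_form_setsum herm_form_coord)
  then have "herm_form (\<lambda>x c. t x c + of_real A * x 1 * cnj (c 1) + of_real B * x N * cnj (c N)
     + (C * x 1 * cnj (c N) + cnj C * x N * cnj (c 1)))"
    by (intro herm_form_plus herm_form_coord herm_form_cross)
  then show ?thesis by (simp add: H_def[abs_def] add.assoc)
qed

lemma subspace_X: "cseq.subspace X"
  by (rule cseq.subspaceI) (auto simp: X_def)

lemma subspace_K: "cseq.subspace (K a b)"
proof (rule cseq.subspaceI)
  show "0 \<in> K a b" using cseq.subspace_0[OF subspace_X] by (simp add: K_def)
  show "x + y \<in> K a b" if "x \<in> K a b" "y \<in> K a b" for x y
  proof -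
    have "a * (x + y) 1 + b * (x + y) N = (a * x 1 + b * x N) + (a * y 1 + b * y N)"
      by (simp add: algebra_simps)
    then show ?thesis using that cseq.subspace_add[OF subspace_X] by (simp add: K_def)
  qed
  show "cscale r x \<in> K a b" if "x \<in> K a b" for r x
  proof -
    have "a * (cscale r x) 1 + b * (cscale r x) N = r * (a * x 1 + b * x N)"
      by (simp add: algebra_simps)
    then show ?thesis using that cseq.subspace_scale[OF subspace_X] by (simp add: K_def)
  qed
qed

lemma closed_X: "closed X"
proof -
  have "X = (\<Inter>n\<in>-{1..N}. {x. x n = 0})" by (auto simp: X_def)
  moreover have "closed \<dots>"
    by (intro closed_INT ballI closed_Collect_eq continuous_on_product_coordinates continuous_on_const)
  ultimately show ?thesis by simp
qed

lemma closed_K: "closed (K a b)"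
proof -
  have "K a b = X \<inter> {x. a * x 1 + b * x N = 0}" by (auto simp: K_def)
  moreover have "closed \<dots>"
    by (intro closed_Int closed_X closed_Collect_eq continuous_intros continuous_on_product_coordinates)
  ultimately show ?thesis by simp
qed

lemma Re_p: "Re (p x x) = (\<Sum>n\<in>{1..N}. w n * (cmod (x n))\<^sup>2)"
proof -
  have "p x x = of_real (\<Sum>n\<in>{1..N}. w n * (cmod (x n))\<^sup>2)"
    unfolding p_def of_real_sum of_real_mult complex_norm_square by (simp add: mult.assoc)
  then show ?thesis by simp
qed

lemma p_coord_le:
  assumes "n \<in> {1..N}"
  shows "w n * (cmod (x n))\<^sup>2 \<le> Re (p x x)"
  unfolding Re_p using assms w_pos
  by (intro member_le_sum) (auto intro!: mult_nonneg_nonneg intro: less_imp_le)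

lemma p_pos:
  assumes "x \<in> X" "x \<noteq> 0"
  shows "Re (p x x) > 0"
proof -
  obtain n where n: "x n \<noteq> 0" using assms(2) by (auto simp: fun_eq_iff)
  then have "n \<in> {1..N}" using assms(1) by (auto simp: X_def)
  moreover from this have "w n * (cmod (x n))\<^sup>2 > 0" using n w_pos by auto
  ultimately show ?thesis using p_coord_le[of n x] by linarith
qed

text \<open>On the sphere coordinate \<open>n\<close> is bounded by \<open>sqrt (1 / w n)\<close>,
  and it is 0 outside 1..N; so the sphere is a closed subset of a product of discs, compact by
  Tychonoff.\<close>

lemma compact_sphere:
  assumes "closed V" "V \<subseteq> X"
  shows "compact {x \<in> V. Re (p x x) = 1}"
proof -
  let ?r = "\<lambda>n. if n \<in> {1..N} then sqrt (1 / w n) else 0"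
  let ?C = "PiE UNIV (\<lambda>n. cball (0::complex) (?r n))"
  have "compactin (product_topology (\<lambda>i. euclidean) UNIV) ?C"
    by (subst compactin_PiE) auto
  then have C: "compact ?C" by (simp add: euclidean_product_topology)
  have sub: "{x \<in> V. Re (p x x) = 1} \<subseteq> ?C"
  proof
    fix x assume x: "x \<in> {x \<in> V. Re (p x x) = 1}"
    have "cmod (x n) \<le> ?r n" for n
    proof (cases "n \<in> {1..N}")
      case True
      then show ?thesis using p_coord_le[OF True, of x] x w_pos[of n]
        by (auto simp: field_simps intro!: real_le_rsqrt)
    next
      case False
      then show ?thesis using x assms(2) by (auto simp: X_def)
    qed
    then show "x \<in> ?C" by (auto simp: PiE_UNIV_domain)
  qed
  have "closed {x. Re (p x x) = 1}"
    by (intro closed_Collect_eq herm_form_cont[OF herm_p] continuous_on_const)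
  then have "closed (V \<inter> {x. Re (p x x) = 1})" using assms(1) by (intro closed_Int)
  also have "V \<inter> {x. Re (p x x) = 1} = {x \<in> V. Re (p x x) = 1}" by auto
  finally have "compact (?C \<inter> {x \<in> V. Re (p x x) = 1})" by (rule compact_Int_closed[OF C])
  then show ?thesis unfolding Int_absorb1[OF sub] .
qed

section \<open>Dimensions of C^N and of its hyperplanes\<close>

definition unit_seq :: "nat \<Rightarrow> nat \<Rightarrow> complex" where
  "unit_seq n = (\<lambda>k. if k = n then 1 else 0)"

lemma unit_X: "n \<in> {1..N} \<Longrightarrow> unit_seq n \<in> X"
  by (auto simp: X_def unit_seq_def)

lemma unit_sum: "(\<Sum>i\<in>{1..N}. cscale (c i) (unit_seq i)) n = (if n \<in> {1..N} then c n else 0)"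
  unfolding sum_seq_apply by (auto simp: unit_seq_def if_distrib cong: if_cong)

lemma unit_ind: "(\<Sum>i\<in>{1..N}. cscale (c i) (unit_seq i)) = 0 \<Longrightarrow> \<forall>i\<in>{1..N}. c i = 0"
proof
  fix i assume "(\<Sum>i\<in>{1..N}. cscale (c i) (unit_seq i)) = 0" and i: "i \<in> {1..N}"
  from fun_cong[OF this(1), of i] show "c i = 0" unfolding unit_sum using i by simp
qed

lemma unit_expand: "x \<in> X \<Longrightarrow> x = (\<Sum>i\<in>{1..N}. cscale (x i) (unit_seq i))"
  by (rule ext, subst unit_sum) (auto simp: X_def)

lemma dim_X: "cseq.dim X = N"
proof -
  have "cseq.dim X = card {1..N}"
  proof (rule cseq_dim_indexed_basis[of _ unit_seq])
    show "\<exists>c. x = (\<Sum>i\<in>{1..N}. cscale (c i) (unit_seq i))" if "x \<in> X" for x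
      using unit_expand[OF that] by blast
  qed (fact finite_atLeastAtMost unit_X unit_ind)+
  then show ?thesis by simp
qed

lemma units_span: "X \<subseteq> cseq.span (unit_seq ` {1..N})"
proof
  fix x assume "x \<in> X"
  note unit_expand[OF this]
  also have "(\<Sum>i\<in>{1..N}. cscale (x i) (unit_seq i)) \<in> cseq.span (unit_seq ` {1..N})"
    by (intro cseq.span_sum cseq.span_scale cseq.span_base imageI)
  finally show "x \<in> cseq.span (unit_seq ` {1..N})" .
qed

lemma herm_space_X: "herm_space X p N"
proof
  show "\<exists>B. finite B \<and> B \<subseteq> X \<and> cseq.independent B \<and> X \<subseteq> cseq.span B \<and> card B = N"
    using cseq_indexed_basis[of "{1..N}" unit_seq, OF _ unit_ind] units_span unit_X
    by (intro exI[of _ "unit_seq ` {1..N}"]) (auto simp: card_image)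
qed (rule subspace_X herm_p p_pos compact_sphere[OF closed_X order_refl]; assumption)+

lemma K_complement:
  assumes "a \<noteq> 0 \<or> b \<noteq> 0"
  shows "\<exists>u\<in>X. a * u 1 + b * u N = 1"
proof (cases "a = 0")
  case True
  then show ?thesis using assms N2 unit_X[of N]
    by (intro bexI[of _ "cscale (1 / b) (unit_seq N)"] cseq.subspace_scale[OF subspace_X]) (auto simp: unit_seq_def)
next
  case False
  then show ?thesis using N2 unit_X[of 1]
    by (intro bexI[of _ "cscale (1 / a) (unit_seq 1)"] cseq.subspace_scale[OF subspace_X]) (auto simp: unit_seq_def)
qed

lemma K_split:
  assumes "u \<in> X" "a * u 1 + b * u N = 1" "c \<in> X"
  shows "c - cscale (a * c 1 + b * c N) u \<in> K a b"
proof -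
  define s where "s = a * c 1 + b * c N"
  have "a * (c - cscale s u) 1 + b * (c - cscale s u) N = s - s * (a * u 1 + b * u N)"
    by (simp add: s_def algebra_simps)
  also have "\<dots> = 0" using assms(2) by simp
  finally show ?thesis
    using cseq.subspace_diff[OF subspace_X assms(3) cseq.subspace_scale[OF subspace_X assms(1)]]
    unfolding K_def s_def by blast
qed

text \<open>A vector \<open>u\<close> on which the functional is 1 spans a complement of the
  hyperplane, so adding it to a basis of \<open>K a b\<close> gives a basis of
  \<open>X\<close>.\<close>

lemma herm_space_K:
  assumes ab: "a \<noteq> 0 \<or> b \<noteq> 0"
  shows "herm_space (K a b) p (N - 1)"
proof
  obtain u where u: "u \<in> X" "a * u 1 + b * u N = 1" using K_complement[OF ab] by auto
  obtain B where B: "B \<subseteq> K a b" "cseq.independent B" "K a b \<subseteq> cseq.span B" "card B = cseq.dim (K a b)"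
    by (rule cseq.basis_exists)
  have BX: "B \<subseteq> X" using B(1) by (auto simp: K_def)
  have fin: "finite B"
    using cseq.independent_span_bound[OF _ B(2) subset_trans[OF BX units_span]] by blast
  have "u \<notin> K a b" using u by (auto simp: K_def)
  then have us: "u \<notin> cseq.span B" using cseq.span_minimal[OF B(1) subspace_K] by blast
  then have ind: "cseq.independent (insert u B)" by (intro cseq.independent_insertI B(2))
  have uB: "u \<notin> B" using us cseq.span_base[of u B] by blast
  have "X \<subseteq> cseq.span (insert u B)"
  proof
    fix c assume c: "c \<in> X"
    define s where "s = a * c 1 + b * c N"
    have "c - cscale s u \<in> cseq.span (insert u B)"
      using subsetD[OF subset_trans[OF B(3) cseq.span_mono[OF subset_insertI]] K_split[OF u c]]
      unfolding s_def .
    moreover have "cscale s u \<in> cseq.span (insert u B)" by (intro cseq.span_scale cseq.span_base) simp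
    ultimately have "c - cscale s u + cscale s u \<in> cseq.span (insert u B)" by (rule cseq.span_add)
    then show "c \<in> cseq.span (insert u B)" by (simp only: diff_add_cancel)
  qed
  then have "cseq.dim X = card (insert u B)"
    using ind BX u(1) by (intro cseq.dim_unique[of "insert u B"]) simp_all
  then have "card B = N - 1" using dim_X fin uB by simp
  then show "\<exists>B. finite B \<and> B \<subseteq> K a b \<and> cseq.independent B \<and> K a b \<subseteq> cseq.span B \<and> card B = N - 1"
    using B fin by blast
  show "compact {x \<in> K a b. Re (p x x) = 1}"
    by (rule compact_sphere[OF closed_K]) (auto simp: K_def)
  show "0 < Re (p x x)" if "x \<in> K a b" "x \<noteq> 0" for x
    using that by (intro p_pos) (simp_all add: K_def)
qed (rule subspace_K herm_p)+

end

section \<open>From boundary value problems to forms\<close>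

context sl_equation
begin

definition R :: "(nat \<Rightarrow> complex) \<Rightarrow> nat \<Rightarrow> complex" where
  "R y = (\<lambda>n. if n \<in> {1..N} then y n else 0)"

abbreviation E :: "bcmat \<Rightarrow> complex \<Rightarrow> (nat \<Rightarrow> complex) set" where
  "E \<equiv> sl_eigspace f q w N"

lemma R_add: "R (x + y) = R x + R y"
  and R_scale: "R (cscale a x) = cscale a (R x)"
  and R_zero: "R 0 = 0"
  by (auto simp: R_def fun_eq_iff)

lemma R_sum: "R (\<Sum>i\<in>I. cscale (c i) (b i)) = (\<Sum>i\<in>I. cscale (c i) (R (b i)))"
proof (induction I rule: infinite_finite_induct)
  case (insert i F)
  then show ?case by (simp only: sum.insert R_add R_scale not_False_eq_True)
qed (simp_all only: sum.infinite sum.empty R_zero not_False_eq_True)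

lemma subspace_E: "cseq.subspace (E M lam)"
proof (rule cseq.subspaceI)
  show "0 \<in> E M lam" by (simp add: sl_eigspace_def)
  show "x + y \<in> E M lam" if xy: "x \<in> E M lam" "y \<in> E M lam" for x y
    unfolding sl_eigspace_def
  proof (intro CollectI conjI ballI allI impI)
    fix n assume "N + 1 < n" then show "(x + y) n = 0" using xy by (auto simp: sl_eigspace_def)
  next
    fix n assume n: "n \<in> {1..N}"
    have e: "- (of_real (f n) * (u (n+1) - u n) - of_real (f (n-1)) * (u n - u (n-1)))
            + of_real (q n) * u n = lam * of_real (w n) * u n" if "u \<in> E M lam" for u
      using that n by (auto simp: sl_eigspace_def)
    show "- (of_real (f n) * ((x + y) (n+1) - (x + y) n) - of_real (f (n-1)) * ((x + y) n - (x + y) (n-1)))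
            + of_real (q n) * (x + y) n = lam * of_real (w n) * (x + y) n"
      using arg_cong2[where f = "(+)", OF e[OF xy(1)] e[OF xy(2)]] by (simp add: algebra_simps)
  next
    fix i :: nat assume i: "i < 2"
    have e: "M i 0 * u 0 + M i 1 * (of_real (f 0) * (u 1 - u 0))
               + M i 2 * u N + M i 3 * (of_real (f N) * (u (N+1) - u N)) = 0" if "u \<in> E M lam" for u
      using that i by (auto simp: sl_eigspace_def)
    show "M i 0 * (x + y) 0 + M i 1 * (of_real (f 0) * ((x + y) 1 - (x + y) 0))
               + M i 2 * (x + y) N + M i 3 * (of_real (f N) * ((x + y) (N+1) - (x + y) N)) = 0"
      using arg_cong2[where f = "(+)", OF e[OF xy(1)] e[OF xy(2)]] by (simp add: algebra_simps)
  qed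
  show "cscale a x \<in> E M lam" if x: "x \<in> E M lam" for a x
    unfolding sl_eigspace_def
  proof (intro CollectI conjI ballI allI impI)
    fix n assume "N + 1 < n" then show "cscale a x n = 0" using x by (auto simp: sl_eigspace_def)
  next
    fix n assume n: "n \<in> {1..N}"
    have e: "- (of_real (f n) * (x (n+1) - x n) - of_real (f (n-1)) * (x n - x (n-1)))
            + of_real (q n) * x n = lam * of_real (w n) * x n"
      using x n by (auto simp: sl_eigspace_def)
    show "- (of_real (f n) * (cscale a x (n+1) - cscale a x n) - of_real (f (n-1)) * (cscale a x n - cscale a x (n-1)))
            + of_real (q n) * cscale a x n = lam * of_real (w n) * cscale a x n"
      using arg_cong[where f = "(*) a", OF e] by (simp add: algebra_simps)
  next
    fix i :: nat assume i: "i < 2"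
    have e: "M i 0 * x 0 + M i 1 * (of_real (f 0) * (x 1 - x 0))
               + M i 2 * x N + M i 3 * (of_real (f N) * (x (N+1) - x N)) = 0"
      using x i by (auto simp: sl_eigspace_def)
    show "M i 0 * cscale a x 0 + M i 1 * (of_real (f 0) * (cscale a x 1 - cscale a x 0))
               + M i 2 * cscale a x N + M i 3 * (of_real (f N) * (cscale a x (N+1) - cscale a x N)) = 0"
      using arg_cong[where f = "(*) a", OF e] by (simp add: algebra_simps)
  qed
qed

text \<open>\<open>R\<close> is injective on eigenspaces: once the interior values vanish, the
  equations at 1 and at \<open>N\<close> force \<open>y 0\<close> and \<open>y (N+1)\<close> to
  vanish, since \<open>f 0\<close> and \<open>f N\<close> are nonzero.\<close>

lemma R_eq_0:
  assumes y: "y \<in> E M lam" and "R y = 0"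
  shows "y = 0"
proof -
  have in0: "y n = 0" if "n \<in> {1..N}" for n
    using fun_cong[OF assms(2), of n] that by (simp add: R_def)
  have out: "y n = 0" if "N + 1 < n" for n using y that by (simp add: sl_eigspace_def)
  have eq: "- (of_real (f n) * (y (n+1) - y n) - of_real (f (n-1)) * (y n - y (n-1)))
            + of_real (q n) * y n = lam * of_real (w n) * y n" if "n \<in> {1..N}" for n
    using y that by (simp add: sl_eigspace_def)
  have "y 0 = 0" using eq[of 1] in0[of 1] in0[of 2] N2 f_nz[of 0] by (simp add: numeral_2_eq_2)
  moreover have "y (N+1) = 0" using eq[of N] in0[of N] in0[of "N - 1"] N2 f_nz[of N] by simp
  ultimately have "y n = 0" for n
    using in0[of n] out[of n] by (cases "n = 0"; cases "n \<in> {1..N}"; cases "n = N + 1") auto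
  then show ?thesis by (simp add: fun_eq_iff)
qed

text \<open>The bridge between the two worlds: for every complex \<open>lam\<close> the restricted
  solutions are the weak eigenvectors of \<open>h\<close> on \<open>V\<close>. All later statements
  about eigenvalues pass through it.\<close>

definition represents where
  "represents M V h d \<longleftrightarrow> herm_space V p d \<and> herm_form h
     \<and> (\<forall>lam. R ` E M lam = {x \<in> V. \<forall>c\<in>V. h x c = lam * p x c})"

text \<open>The orthonormal eigenvectors for \<open>lam\<close> are lifted along \<open>R\<close>;
  by injectivity of \<open>R\<close> the lifts form a basis of the eigenspace.\<close>

lemma sl_mult_represents:
  assumes r: "represents M V h d" and e: "herm_space.eigen_sys V p h e l d"
  shows "sl_mult f q w N M lam = card {i. i < d \<and> of_real (l i) = lam}"
proof -
  interpret V: herm_space V p d using r by (simp add: represents_def)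
  have h: "herm_form h" and RE: "R ` E M lam = {x \<in> V. \<forall>c\<in>V. h x c = lam * p x c}"
    using r by (simp_all add: represents_def)
  have on: "V.onf e d" using e by (simp add: V.eigen_sys_def)
  let ?I = "{i. i < d \<and> of_real (l i) = lam}"
  have "\<exists>y. y \<in> E M lam \<and> R y = e i" if "i \<in> ?I" for i
  proof -
    have "e i \<in> R ` E M lam"
      unfolding RE using that e by (auto simp: V.eigen_sys_def V.onf_def)
    then obtain y where "e i = R y" "y \<in> E M lam" by (rule imageE)
    then show ?thesis by (intro exI[of _ y] conjI) simp_all
  qed
  then have "\<forall>i\<in>?I. \<exists>y. y \<in> E M lam \<and> R y = e i" by (rule ballI)
  from bchoice[OF this] obtain b where b': "\<forall>i\<in>?I. b i \<in> E M lam \<and> R (b i) = e i" ..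
  have b: "b i \<in> E M lam" "R (b i) = e i" if "i \<in> ?I" for i using bspec[OF b' that] by simp_all
  have Rb: "R (\<Sum>i\<in>?I. cscale (c i) (b i)) = (\<Sum>i\<in>?I. cscale (c i) (e i))" for c
    unfolding R_sum by (intro sum.cong refl) (simp only: b(2))
  have "cseq.dim (E M lam) = card ?I"
  proof (rule cseq_dim_indexed_basis)
    show "finite ?I" by simp
    show "b i \<in> E M lam" if "i \<in> ?I" for i by (rule b(1)[OF that])
  next
    fix x assume x: "x \<in> E M lam"
    then have "R x \<in> {x \<in> V. \<forall>c\<in>V. h x c = lam * p x c}" using RE by blast
    then have ex: "R x = (\<Sum>i\<in>?I. cscale (p (R x) (e i)) (e i))"
      by (intro V.eigenspace_expand[OF h e]) simp_all
    define c where "c i = p (R x) (e i)" for i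
    have c: "R x = (\<Sum>i\<in>?I. cscale (c i) (e i))" unfolding c_def by (rule ex)
    define s where "s = (\<Sum>i\<in>?I. cscale (c i) (b i))"
    have "s \<in> E M lam" unfolding s_def
      by (intro cseq.subspace_sum[OF subspace_E] cseq.subspace_scale[OF subspace_E] b(1))
    then have xs: "x - s \<in> E M lam" using x by (intro cseq.subspace_diff[OF subspace_E])
    have "R (x - s) + R s = R x" unfolding R_add[symmetric] diff_add_cancel ..
    also have "\<dots> = R s" unfolding s_def Rb c ..
    finally have "R (x - s) = 0" unfolding add_cancel_left_left .
    then have "x - s = 0" using R_eq_0[OF xs] by blast
    then have "x = s" by (simp only: right_minus_eq)
    then show "\<exists>c. x = (\<Sum>i\<in>?I. cscale (c i) (b i))" unfolding s_def by blast
  next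
    fix c assume c: "(\<Sum>i\<in>?I. cscale (c i) (b i)) = 0"
    have 0: "(\<Sum>i\<in>?I. cscale (c i) (e i)) = 0" unfolding Rb[symmetric] c by (rule R_zero)
    show "\<forall>i\<in>?I. c i = 0"
    proof
      fix i assume i: "i \<in> ?I"
      have "p (\<Sum>i\<in>?I. cscale (c i) (e i)) (e i) = c i"
        by (subst V.onf_coeff[OF on]) (use i in auto)
      then show "c i = 0" unfolding 0 herm_form_zero[OF herm_p] by simp
    qed
  qed
  moreover have "cscale = (\<lambda>c y n. c * y n)" by (simp add: fun_eq_iff)
  ultimately show ?thesis by (simp add: sl_mult_def)
qed

lemma sl_is_eigenvalue_represents:
  assumes r: "represents M V h d" and e: "herm_space.eigen_sys V p h e l d"
  shows "sl_is_eigenvalue f q w N M lam \<longleftrightarrow> (\<exists>i<d. of_real (l i) = lam)"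
proof -
  interpret V: herm_space V p d using r by (simp add: represents_def)
  have h: "herm_form h" and RE: "R ` E M lam = {x \<in> V. \<forall>c\<in>V. h x c = lam * p x c}"
    using r by (simp_all add: represents_def)
  show ?thesis
  proof
    assume "sl_is_eigenvalue f q w N M lam"
    then obtain y where y: "y \<in> E M lam" "y \<noteq> 0" by (auto simp: sl_is_eigenvalue_def)
    then have "R y \<in> {x \<in> V. \<forall>c\<in>V. h x c = lam * p x c}" using RE by blast
    then have ex: "R y = (\<Sum>i | i < d \<and> of_real (l i) = lam. cscale (p (R y) (e i)) (e i))"
      by (intro V.eigenspace_expand[OF h e]) simp_all
    show "\<exists>i<d. of_real (l i) = lam"
    proof (rule ccontr)
      assume "\<not> ?thesis"
      then have "{i. i < d \<and> of_real (l i) = lam} = {}" by blast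
      then have "R y = 0" using ex by (simp only: sum.empty)
      then show False using R_eq_0 y by blast
    qed
  next
    assume "\<exists>i<d. of_real (l i) = lam"
    then obtain i where i: "i < d" "of_real (l i) = lam" by auto
    then have "e i \<in> R ` E M lam"
      unfolding RE using e by (auto simp: V.eigen_sys_def V.onf_def)
    then obtain y where y: "y \<in> E M lam" "e i = R y" by auto
    have "p (e i) (e i) = 1" using e i by (auto simp: V.eigen_sys_def V.onf_def)
    then have "y \<noteq> 0" using y(2) R_zero herm_form_zero[OF herm_p] by (metis zero_neq_one)
    then show "sl_is_eigenvalue f q w N M lam" using y by (auto simp: sl_is_eigenvalue_def)
  qed
qed

lemma sl_spectrum:
  assumes r: "represents M V h d" and e: "herm_space.eigen_sys V p h e l d"
  shows "sl_eig_mset f q w N M = mset (map l [0..<d])" and "sl_num f q w N M = d"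
    and "\<And>n. n < d \<Longrightarrow> sl_ev f q w N M n = l n"
proof -
  interpret V: herm_space V p d using r by (simp add: represents_def)
  \<comment> \<open>The spectrum is real, so the sums over complex eigenvalues can be reindexed by
    real ones, where \<open>Re\<close> is harmless.\<close>
  have S: "{lam. sl_is_eigenvalue f q w N M lam} = complex_of_real ` l ` {..<d}"
    using sl_is_eigenvalue_represents[OF r e] by auto
  have inj: "inj_on complex_of_real A" for A by (simp add: inj_on_def)
  have mult: "sl_mult f q w N M (of_real a) = count (mset (map l [0..<d])) a" for a
  proof -
    have "count (mset (map l [0..<d])) a = length (filter (\<lambda>x. l x = a) [0..<d])"
      by (simp only: count_mset count_list_eq_length_filter filter_map length_map comp_def eq_commute[of a])
    also have "\<dots> = card {i. i < d \<and> l i = a}"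
      by (subst distinct_card[symmetric]) (auto intro!: arg_cong[where f = card])
    finally show ?thesis by (simp add: sl_mult_represents[OF r e])
  qed
  show m: "sl_eig_mset f q w N M = mset (map l [0..<d])"
  proof (rule multiset_eqI)
    fix a
    have "count (sl_eig_mset f q w N M) a
        = (\<Sum>b\<in>l ` {..<d}. if b = a then count (mset (map l [0..<d])) b else 0)"
      unfolding sl_eig_mset_def S sum.reindex[OF inj] count_sum o_def mult by (intro sum.cong) auto
    also have "\<dots> = count (mset (map l [0..<d])) a"
      by (auto simp: count_eq_zero_iff)
    finally show "count (sl_eig_mset f q w N M) a = count (mset (map l [0..<d])) a" .
  qed
  have "sl_num f q w N M = (\<Sum>b\<in>l ` {..<d}. count (mset (map l [0..<d])) b)"
    unfolding sl_num_def S sum.reindex[OF inj] o_def mult ..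
  also have "\<dots> = size (mset (map l [0..<d]))"
    unfolding size_multiset_overloaded_eq by (simp add: lessThan_atLeast0)
  finally show "sl_num f q w N M = d" by simp
  fix n assume n: "n < d"
  have "sorted (map l [0..<d])"
    using e by (auto simp: V.eigen_sys_def sorted_iff_nth_mono)
  then have "sorted_list_of_multiset (mset (map l [0..<d])) = map l [0..<d]"
    unfolding sorted_list_of_multiset_mset by (rule sorted_sort_id)
  then show "sl_ev f q w N M n = l n" using n unfolding sl_ev_def m by simp
qed

section \<open>Counting and comparing the eigenvalues of represented problems\<close>

lemma represents_spectral:
  assumes "represents M V h d"
  obtains e l where "herm_space.eigen_sys V p h e l d"
  using herm_space.spectral[of V p d h] assms unfolding represents_def by blast

lemma sl_num_represents: "represents M V h d \<Longrightarrow> sl_num f q w N M = d"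
  using represents_spectral sl_spectrum(2) by metis

text \<open>Both shrinking the space and enlarging the form raise the eigenvalues; the case without
  constraints of \<open>eigen_sys_compare\<close>.\<close>

lemma sl_ev_mono:
  assumes r1: "represents M1 V1 h1 d1" and r2: "represents M2 V2 h2 d2" and sub: "V2 \<subseteq> V1"
    and le: "\<And>x. x \<in> V2 \<Longrightarrow> Re (h1 x x) \<le> Re (h2 x x)" and n: "n < d1" "n < d2"
  shows "sl_ev f q w N M1 n \<le> sl_ev f q w N M2 n"
proof -
  obtain e1 l1 where e1: "herm_space.eigen_sys V1 p h1 e1 l1 d1" using represents_spectral[OF r1] .
  obtain e2 l2 where e2: "herm_space.eigen_sys V2 p h2 e2 l2 d2" using represents_spectral[OF r2] .
  have "l1 n \<le> l2 (n + 0)"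
    by (rule eigen_sys_compare[OF _ _ _ _ e1 e2, of "\<lambda>_ _. 0"])
      (use r1 r2 sub le n in \<open>auto simp: represents_def\<close>)
  then show ?thesis using sl_spectrum(3)[OF r1 e1 n(1)] sl_spectrum(3)[OF r2 e2 n(2)] by simp
qed

text \<open>The opposite direction: the functional defining the hyperplane is one constraint and
  costs one index.\<close>

lemma sl_ev_mono_Suc:
  assumes r1: "represents M1 (K a b) h1 d1" and r2: "represents M2 X h2 d2"
    and le: "\<And>x. x \<in> K a b \<Longrightarrow> Re (h1 x x) \<le> Re (h2 x x)" and n: "n < d1" "n + 1 < d2"
  shows "sl_ev f q w N M1 n \<le> sl_ev f q w N M2 (n + 1)"
proof -
  obtain e1 l1 where e1: "herm_space.eigen_sys (K a b) p h1 e1 l1 d1" using represents_spectral[OF r1] .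
  obtain e2 l2 where e2: "herm_space.eigen_sys X p h2 e2 l2 d2" using represents_spectral[OF r2] .
  have "l1 n \<le> l2 (n + 1)"
  proof (rule eigen_sys_compare[OF _ _ _ _ e1 e2, of "\<lambda>_ x. a * x 1 + b * x N"])
    fix x assume "x \<in> X" "\<And>j. j < (1::nat) \<Longrightarrow> a * x 1 + b * x N = 0"
    then show "x \<in> K a b \<and> Re (h1 x x) \<le> Re (h2 x x)" using le[of x] by (simp add: K_def)
  qed (use r1 r2 n in \<open>simp_all add: represents_def algebra_simps\<close>)
  then show ?thesis using sl_spectrum(3)[OF r1 e1 n(1)] sl_spectrum(3)[OF r2 e2 n(2)] by simp
qed


section \<open>Weak formulation of the boundary value problem\<close>

lemma summation_by_parts:
  fixes F c :: "nat \<Rightarrow> complex"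
  assumes "1 \<le> m"
  shows "(\<Sum>n\<in>{1..m}. - (F n - F (n-1)) * c n) = (\<Sum>n\<in>{1..<m}. F n * (c (n+1) - c n)) - F m * c m + F 0 * c 1"
  using assms by (induction m rule: nat_induct_at_least) (simp_all add: algebra_simps)

lemma weak_identity:
  "(\<Sum>n\<in>{1..N}. (- (of_real (f n) * (y (n+1) - y n) - of_real (f (n-1)) * (y n - y (n-1)))
      + of_real (q n) * y n - lam * of_real (w n) * y n) * cnj (c n))
   = t y c - of_real (f N) * (y (N+1) - y N) * cnj (c N) - of_real (f 0) * y 0 * cnj (c 1) - lam * p y c"
proof -
  define F where "F n = of_real (f n) * (y (n+1) - y n)" for n
  have "(\<Sum>n\<in>{1..N}. (- (of_real (f n) * (y (n+1) - y n) - of_real (f (n-1)) * (y n - y (n-1)))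
      + of_real (q n) * y n - lam * of_real (w n) * y n) * cnj (c n))
    = (\<Sum>n\<in>{1..N}. - (F n - F (n-1)) * cnj (c n) + of_real (q n) * y n * cnj (c n)
        - lam * (of_real (w n) * y n * cnj (c n)))"
    by (intro sum.cong refl) (auto simp: F_def algebra_simps)
  also have "\<dots> = (\<Sum>n\<in>{1..N}. - (F n - F (n-1)) * cnj (c n)) + (\<Sum>n\<in>{1..N}. of_real (q n) * y n * cnj (c n))
        - lam * p y c"
    by (simp only: sum_subtractf sum.distrib p_def sum_distrib_left)
  also have "(\<Sum>n\<in>{1..N}. - (F n - F (n-1)) * cnj (c n))
      = (\<Sum>n\<in>{1..<N}. F n * (cnj (c (n+1)) - cnj (c n))) - F N * cnj (c N) + F 0 * cnj (c 1)"
    using summation_by_parts[of N F "\<lambda>n. cnj (c n)"] N2 by simp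
  finally show ?thesis by (simp add: t_def F_def algebra_simps)
qed

lemma t_R: "t (R y) c = t y c" and p_R: "p (R y) c = p y c"
  using N2 by (auto simp: t_def p_def R_def intro!: arg_cong2[where f = "(+)"] sum.cong)

lemma R_X: "R y \<in> X"
  by (simp add: R_def X_def)

text \<open>The parameter \<open>y0\<close> is the value of the solution at 0 and \<open>v\<close> its quasi-derivative
  \<open>f\<^sub>N \<Delta>y\<^sub>N\<close> at \<open>N\<close>.\<close>

definition bc :: "bcmat \<Rightarrow> (nat \<Rightarrow> complex) \<Rightarrow> complex \<Rightarrow> complex \<Rightarrow> bool" where
  "bc M x y0 v \<longleftrightarrow> (\<forall>i<2. M i 0 * y0 + M i 1 * (of_real (f 0) * (x 1 - y0)) + M i 2 * x N + M i 3 * v = 0)"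

text \<open>A solution is its interior part together with \<open>y0\<close> and \<open>v\<close>,
  from which \<open>y (N+1) = x N + v / f N\<close> is recovered. The converse direction tests with
  unit sequences to get the difference equation back pointwise.\<close>

lemma R_image_E:
  "x \<in> R ` E M lam \<longleftrightarrow> x \<in> X \<and> (\<exists>y0 v. bc M x y0 v \<and>
     (\<forall>c\<in>X. t x c - v * cnj (c N) - of_real (f 0) * y0 * cnj (c 1) = lam * p x c))"
proof
  assume "x \<in> R ` E M lam"
  then obtain y where y: "y \<in> E M lam" "x = R y" by auto
  have xy: "x 1 = y 1" "x N = y N" using y(2) N2 by (auto simp: R_def)
  let ?v = "of_real (f N) * (y (N+1) - y N)"
  have "bc M x (y 0) ?v" using y(1) unfolding bc_def xy by (simp add: sl_eigspace_def)
  moreover have "t x c - ?v * cnj (c N) - of_real (f 0) * y 0 * cnj (c 1) = lam * p x c" for c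
  proof -
    have "(\<Sum>n\<in>{1..N}. (- (of_real (f n) * (y (n+1) - y n) - of_real (f (n-1)) * (y n - y (n-1)))
      + of_real (q n) * y n - lam * of_real (w n) * y n) * cnj (c n)) = 0"
      using y(1) by (intro sum.neutral) (auto simp: sl_eigspace_def)
    then show ?thesis unfolding weak_identity y(2) t_R p_R by (simp add: algebra_simps)
  qed
  ultimately show "x \<in> X \<and> (\<exists>y0 v. bc M x y0 v \<and>
     (\<forall>c\<in>X. t x c - v * cnj (c N) - of_real (f 0) * y0 * cnj (c 1) = lam * p x c))"
    using R_X y(2) by blast
next
  assume "x \<in> X \<and> (\<exists>y0 v. bc M x y0 v \<and>
     (\<forall>c\<in>X. t x c - v * cnj (c N) - of_real (f 0) * y0 * cnj (c 1) = lam * p x c))"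
  then obtain y0 v where x: "x \<in> X" and bc: "bc M x y0 v"
    and weak: "\<And>c. c \<in> X \<Longrightarrow> t x c - v * cnj (c N) - of_real (f 0) * y0 * cnj (c 1) = lam * p x c"
    by blast
  define y where "y = (\<lambda>n. if n = 0 then y0 else if n = N + 1 then x N + v / of_real (f N) else x n)"
  have Ry: "R y = x" using x by (auto simp: R_def y_def X_def fun_eq_iff)
  have y0: "y 0 = y0" and y1: "y 1 = x 1" and yN: "y N = x N"
    and v: "of_real (f N) * (y (N+1) - y N) = v"
    using N2 f_nz[of N] by (auto simp: y_def)
  have "- (of_real (f n) * (y (n+1) - y n) - of_real (f (n-1)) * (y n - y (n-1)))
      + of_real (q n) * y n = lam * of_real (w n) * y n" if n: "n \<in> {1..N}" for n
  proof -
    let ?g = "\<lambda>n. - (of_real (f n) * (y (n+1) - y n) - of_real (f (n-1)) * (y n - y (n-1)))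
      + of_real (q n) * y n - lam * of_real (w n) * y n"
    have "?g n = (\<Sum>k\<in>{1..N}. ?g k * cnj (unit_seq n k))"
      using n by (simp add: unit_seq_def if_distrib cong: if_cong)
    also have "\<dots> = 0"
      unfolding weak_identity v y0 using weak[OF unit_X[OF n]] t_R[of y] p_R[of y] Ry by simp
    finally show ?thesis by simp
  qed
  moreover have "y n = 0" if "N + 1 < n" for n using x that by (auto simp: y_def X_def)
  ultimately have "y \<in> E M lam"
    using bc v unfolding sl_eigspace_def bc_def y0 y1 yN mem_Collect_eq by metis
  then show "x \<in> R ` E M lam" using Ry by blast
qed

lemma represents_X:
  assumes bc: "\<And>x y0 v. bc M x y0 v \<longleftrightarrow> y0 = Y x \<and> v = U x" and h: "herm_form h"
    and form: "\<And>x c. h x c = t x c - U x * cnj (c N) - of_real (f 0) * Y x * cnj (c 1)"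
  shows "represents M X h N"
proof -
  have "R ` E M lam = {x \<in> X. \<forall>c\<in>X. h x c = lam * p x c}" for lam
    by (rule set_eqI) (simp add: R_image_E bc form)
  then show ?thesis unfolding represents_def using herm_space_X h by blast
qed

text \<open>When the boundary values are determined only up to a multiple \<open>\<kappa>\<close> of the vector conjugate to the
  constraint, \<open>\<kappa>\<close> acts as a Lagrange multiplier for that constraint.\<close>

lemma represents_K:
  assumes ab: "a \<noteq> 0 \<or> b \<noteq> 0"
    and bc: "\<And>x y0 v. bc M x y0 v \<longleftrightarrow> a * x 1 + b * x N = 0 \<and> (\<exists>\<kappa>. y0 = Y x + \<kappa> * k0 \<and> v = U x + \<kappa> * cnj b)"
    and k0: "of_real (f 0) * k0 = cnj a" and h: "herm_form h"
    and form: "\<And>x c. h x c = t x c - U x * cnj (c N) - of_real (f 0) * Y x * cnj (c 1)"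
  shows "represents M (K a b) h (N - 1)"
proof -
  have shift: "t x c - (U x + \<kappa> * cnj b) * cnj (c N) - of_real (f 0) * (Y x + \<kappa> * k0) * cnj (c 1)
      = h x c - \<kappa> * cnj (a * c 1 + b * c N)" for x c \<kappa>
  proof -
    have "of_real (f 0) * (Y x + \<kappa> * k0) = of_real (f 0) * Y x + \<kappa> * cnj a"
      unfolding k0[symmetric] by (simp add: algebra_simps)
    then show ?thesis by (simp only: form complex_cnj_add complex_cnj_mult) (simp add: algebra_simps)
  qed
  have "R ` E M lam = {x \<in> K a b. \<forall>c\<in>K a b. h x c = lam * p x c}" for lam
  proof (intro set_eqI iffI)
    fix x assume "x \<in> R ` E M lam"
    then obtain \<kappa> where "x \<in> X" "a * x 1 + b * x N = 0"
      and "\<forall>c\<in>X. t x c - (U x + \<kappa> * cnj b) * cnj (c N) - of_real (f 0) * (Y x + \<kappa> * k0) * cnj (c 1) = lam * p x c"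
      unfolding R_image_E bc by blast
    note this(1,2) and * = this(3)[unfolded shift, rule_format]
    moreover have "h x c = lam * p x c" if "c \<in> K a b" for c
    proof -
      have "c \<in> X" and c0: "a * c 1 + b * c N = 0" using that by (simp_all add: K_def)
      from *[OF this(1)] show ?thesis unfolding c0 by simp
    qed
    ultimately show "x \<in> {x \<in> K a b. \<forall>c\<in>K a b. h x c = lam * p x c}"
      by (simp add: K_def)
  next
    fix x assume x: "x \<in> {x \<in> K a b. \<forall>c\<in>K a b. h x c = lam * p x c}"
    obtain u where u: "u \<in> X" "a * u 1 + b * u N = 1" using K_complement[OF ab] by auto
    \<comment> \<open>The multiplier is the defect of the eigenvalue equation at \<open>u\<close>,
      on which the functional is 1; on \<open>K a b\<close> there is no defect.\<close>
    define \<kappa> where "\<kappa> = h x u - lam * p x u"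
    have "h x c - \<kappa> * cnj (a * c 1 + b * c N) = lam * p x c" if c: "c \<in> X" for c
    proof -
      define s where "s = a * c 1 + b * c N"
      have "h x (c - cscale s u) = lam * p x (c - cscale s u)"
        using x K_split[OF u c] unfolding s_def by blast
      then have "h x c - cnj s * h x u = lam * (p x c - cnj s * p x u)"
        unfolding herm_form_minus_right[OF h] herm_form_minus_right[OF herm_p]
          herm_form_scale_right[OF h] herm_form_scale_right[OF herm_p] .
      then show ?thesis unfolding s_def[symmetric] by (simp add: \<kappa>_def algebra_simps)
    qed
    then have "\<forall>c\<in>X. t x c - (U x + \<kappa> * cnj b) * cnj (c N) - of_real (f 0) * (Y x + \<kappa> * k0) * cnj (c 1) = lam * p x c"
      unfolding shift by blast
    moreover have "bc M x (Y x + \<kappa> * k0) (U x + \<kappa> * cnj b)" "x \<in> X"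
      using x unfolding bc by (auto simp: K_def)
    ultimately show "x \<in> R ` E M lam" unfolding R_image_E by blast
  qed
  then show ?thesis unfolding represents_def using herm_space_K[OF ab] h by blast
qed


section \<open>The forms belonging to A, S_5 and S_6\<close>

text \<open>The quasi-derivative at 0 is \<open>f 0 * (x 1 - y0)\<close>; collecting its
  \<open>y0\<close> with the \<open>a11\<close> term is the origin of
  \<open>a11 + f 0\<close>.\<close>

lemma bc_bcA: "bc (bcA z a11 b22) x y0 v \<longleftrightarrow>
    of_real (a11 + f 0) * y0 + cnj z * v = of_real (f 0) * x 1 \<and> z * y0 + of_real b22 * v = x N"
  unfolding bc_def less_2_cases_iff
  by (auto simp: bcA_def bc2x4_def algebra_simps eq_neg_iff_add_eq_0)

lemma bc_bcS5: "bc (bcS5 b22) x y0 v \<longleftrightarrow> y0 = 0 \<and> of_real b22 * v = x N"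
  unfolding bc_def less_2_cases_iff
  by (auto simp: bcS5_def bc2x4_def algebra_simps eq_neg_iff_add_eq_0)

lemma bc_bcS6: "bc (bcS6 a11) x y0 v \<longleftrightarrow> of_real (a11 + f 0) * y0 = of_real (f 0) * x 1 \<and> v = 0"
  unfolding bc_def less_2_cases_iff
  by (auto simp: bcS6_def bc2x4_def algebra_simps eq_neg_iff_add_eq_0)

text \<open>Cramer's rule for the system in \<open>bc_bcA\<close>, whose determinant is
  \<open>D\<close>.\<close>

lemma bcA_regular:
  fixes a11 b22 :: real and z :: complex
  defines "D \<equiv> b22 * (a11 + f 0) - (cmod z)\<^sup>2"
  assumes D: "D \<noteq> 0"
  shows "represents (bcA z a11 b22) X
    (H (- ((f 0)\<^sup>2 * b22) / D) (- (a11 + f 0) / D) (of_real (f 0 / D) * z)) N"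
proof (rule represents_X[OF _ herm_H])
  let ?\<alpha> = "complex_of_real (a11 + f 0)" and ?\<beta> = "complex_of_real b22" and ?D = "complex_of_real D"
  have D0: "?D \<noteq> 0" using D by simp
  have DD: "?D = ?\<beta> * ?\<alpha> - z * cnj z"
    unfolding D_def of_real_diff of_real_mult[of b22] complex_norm_square ..
  fix x :: "nat \<Rightarrow> complex" and y0 v
  let ?g = "complex_of_real (f 0) * x 1"
  show "bc (bcA z a11 b22) x y0 v \<longleftrightarrow>
      y0 = (?\<beta> * ?g - cnj z * x N) / ?D \<and> v = (?\<alpha> * x N - z * ?g) / ?D"
    unfolding bc_bcA
  proof (intro iffI conjI; elim conjE)
    assume e: "?\<alpha> * y0 + cnj z * v = ?g" "z * y0 + ?\<beta> * v = x N"
    show "y0 = (?\<beta> * ?g - cnj z * x N) / ?D"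
      unfolding nonzero_eq_divide_eq[OF D0] unfolding DD e[symmetric] by (simp only: algebra_simps)
    show "v = (?\<alpha> * x N - z * ?g) / ?D"
      unfolding nonzero_eq_divide_eq[OF D0] unfolding DD e[symmetric] by (simp only: algebra_simps)
  next
    assume y: "y0 = (?\<beta> * ?g - cnj z * x N) / ?D" and v: "v = (?\<alpha> * x N - z * ?g) / ?D"
    have "?\<alpha> * y0 + cnj z * v = (?\<beta> * ?\<alpha> - z * cnj z) * ?g / ?D"
      unfolding y v by (simp add: algebra_simps add_divide_distrib diff_divide_distrib)
    then show "?\<alpha> * y0 + cnj z * v = ?g" using D0 unfolding DD[symmetric] by simp
    have "z * y0 + ?\<beta> * v = (?\<beta> * ?\<alpha> - z * cnj z) * x N / ?D"
      unfolding y v by (simp add: algebra_simps add_divide_distrib diff_divide_distrib)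
    then show "z * y0 + ?\<beta> * v = x N" using D0 unfolding DD[symmetric] by simp
  qed
next
  fix x c
  show "H (- ((f 0)\<^sup>2 * b22) / D) (- (a11 + f 0) / D) (of_real (f 0 / D) * z) x c =
    t x c - (of_real (a11 + f 0) * x N - z * (of_real (f 0) * x 1)) / of_real D * cnj (c N)
     - of_real (f 0) * ((of_real b22 * (of_real (f 0) * x 1) - cnj z * x N) / of_real D) * cnj (c 1)"
    by (simp add: H_def power2_eq_square algebra_simps add_divide_distrib diff_divide_distrib)
qed

lemma S5_regular:
  assumes "b22 \<noteq> 0"
  shows "represents (bcS5 b22) X (H 0 (- 1 / b22) 0) N"
proof (rule represents_X[OF _ herm_H])
  show "bc (bcS5 b22) x y0 v \<longleftrightarrow> y0 = 0 \<and> v = x N / of_real b22" for x y0 v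
    unfolding bc_bcS5 using assms by (auto simp: field_simps)
qed (simp add: H_def)

lemma S6_regular:
  assumes "a11 + f 0 \<noteq> 0"
  shows "represents (bcS6 a11) X (H (- (f 0)\<^sup>2 / (a11 + f 0)) 0 0) N"
proof (rule represents_X[OF _ herm_H])
  have "complex_of_real (a11 + f 0) \<noteq> 0" using assms by (simp only: of_real_eq_0_iff not_False_eq_True)
  then show "bc (bcS6 a11) x y0 v \<longleftrightarrow> y0 = of_real (f 0) * x 1 / of_real (a11 + f 0) \<and> v = 0" for x y0 v
    unfolding bc_bcS6 by (auto simp: eq_divide_eq mult.commute)
qed (simp add: H_def power2_eq_square)

text \<open>The condition becomes \<open>y0 = 0\<close> and \<open>x N = 0\<close> and leaves
  \<open>v\<close> free, so \<open>v\<close> itself is the multiplier. In \<open>S6_singular\<close>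
  this role falls to \<open>y0\<close>.\<close>

lemma S5_singular: "represents (bcS5 0) (K 0 1) (H 0 0 0) (N - 1)"
  by (rule represents_K[where Y = "\<lambda>_. 0" and U = "\<lambda>_. 0" and ?k0.0 = 0])
    (auto simp: bc_bcS5 H_def herm_H)

lemma S6_singular:
  assumes "a11 + f 0 = 0"
  shows "represents (bcS6 a11) (K (of_real (f 0)) 0) (H 0 0 0) (N - 1)"
  by (rule represents_K[where Y = "\<lambda>_. 0" and U = "\<lambda>_. 0" and ?k0.0 = 1])
    (use assms f_nz[of 0] in \<open>auto simp: bc_bcS6 H_def herm_H simp flip: of_real_add\<close>)

text \<open>The second equation gives \<open>v\<close> in terms of the free \<open>y0\<close>; as
  the determinant is 0, \<open>y0\<close> cancels from the first, which becomes the constraint. The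
  lemma \<open>bcA_singular_a\<close> describes the same problems with the form of S_6 instead of
  S_5, by solving for \<open>y0\<close> and leaving \<open>v\<close> free.\<close>

lemma bcA_singular_b:
  assumes D: "b22 * (a11 + f 0) = (cmod z)\<^sup>2" and z: "z \<noteq> 0"
  shows "represents (bcA z a11 b22) (K (of_real (f 0)) (- cnj z / of_real b22)) (H 0 (- 1 / b22) 0) (N - 1)"
proof (rule represents_K[OF _ _ _ herm_H])
  have b0: "b22 \<noteq> 0" using D z by auto
  let ?\<alpha> = "complex_of_real (a11 + f 0)" and ?\<beta> = "complex_of_real b22"
  have \<alpha>: "?\<alpha> = z * cnj z / ?\<beta>"
    using b0 unfolding complex_norm_square[symmetric] D[symmetric] by simp
  fix x :: "nat \<Rightarrow> complex" and y0 v
  have e2: "z * y0 + ?\<beta> * v = x N \<longleftrightarrow> v = x N / ?\<beta> + y0 * cnj (- cnj z / ?\<beta>)"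
    using b0 by (auto simp: field_simps)
  have e1: "?\<alpha> * y0 + cnj z * (x N / ?\<beta> + y0 * cnj (- cnj z / ?\<beta>)) = cnj z * x N / ?\<beta>"
    unfolding \<alpha> by (simp add: algebra_simps)
  have l0: "of_real (f 0) * x 1 + - cnj z / ?\<beta> * x N = 0 \<longleftrightarrow> cnj z * x N / ?\<beta> = of_real (f 0) * x 1"
    by auto
  show "bc (bcA z a11 b22) x y0 v \<longleftrightarrow>
      of_real (f 0) * x 1 + - cnj z / ?\<beta> * x N = 0 \<and>
      (\<exists>\<kappa>. y0 = 0 + \<kappa> * 1 \<and> v = x N / ?\<beta> + \<kappa> * cnj (- cnj z / ?\<beta>))"
    unfolding bc_bcA e2 l0 using e1 by auto
qed (use f_nz[of 0] in \<open>auto simp: H_def\<close>)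

lemma bcA_singular_a:
  assumes D: "b22 * (a11 + f 0) = (cmod z)\<^sup>2" and z: "z \<noteq> 0"
  shows "represents (bcA z a11 b22) (K (- z * of_real (f 0) / of_real (a11 + f 0)) 1)
    (H (- (f 0)\<^sup>2 / (a11 + f 0)) 0 0) (N - 1)"
proof (rule represents_K[OF _ _ _ herm_H])
  let ?\<alpha> = "complex_of_real (a11 + f 0)" and ?\<beta> = "complex_of_real b22" and ?f = "complex_of_real (f 0)"
  have "a11 + f 0 \<noteq> 0" using D z by auto
  then have a0: "?\<alpha> \<noteq> 0" by (simp only: of_real_eq_0_iff not_False_eq_True)
  have \<beta>: "?\<beta> = z * cnj z / ?\<alpha>"
    using a0 unfolding complex_norm_square[symmetric] D[symmetric] of_real_mult by (rule nonzero_mult_div_cancel_right[symmetric])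
  fix x :: "nat \<Rightarrow> complex" and y0 v
  have e2: "?\<alpha> * y0 + cnj z * v = ?f * x 1 \<longleftrightarrow> y0 = ?f * x 1 / ?\<alpha> + v * (- cnj z / ?\<alpha>)"
    using a0 by (auto simp: field_simps simp del: of_real_add)
  have e1: "z * (?f * x 1 / ?\<alpha> + v * (- cnj z / ?\<alpha>)) + ?\<beta> * v = z * ?f / ?\<alpha> * x 1"
    unfolding \<beta> by (simp add: algebra_simps del: of_real_add)
  have l0: "- z * ?f / ?\<alpha> * x 1 + 1 * x N = 0 \<longleftrightarrow> z * ?f / ?\<alpha> * x 1 = x N"
    by (auto simp del: of_real_add)
  show "bc (bcA z a11 b22) x y0 v \<longleftrightarrow>
      - z * ?f / ?\<alpha> * x 1 + 1 * x N = 0 \<and>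
      (\<exists>\<kappa>. y0 = ?f * x 1 / ?\<alpha> + \<kappa> * (- cnj z / ?\<alpha>) \<and> v = 0 + \<kappa> * cnj 1)"
    unfolding bc_bcA e2 l0 using e1 by auto
next
  show "H (- (f 0)\<^sup>2 / (a11 + f 0)) 0 0 x c = t x c - 0 * cnj (c N)
      - of_real (f 0) * (of_real (f 0) * x 1 / of_real (a11 + f 0)) * cnj (c 1)" for x c
    by (simp add: H_def power2_eq_square)
qed simp_all

section \<open>Completing the square in the boundary terms\<close>

lemma Re_H: "Re (H A B C x x) = Re (t x x) + A * (cmod (x 1))\<^sup>2 + B * (cmod (x N))\<^sup>2 + 2 * Re (C * x 1 * cnj (x N))"
proof -
  have "H A B C x x = t x x + of_real (A * (cmod (x 1))\<^sup>2) + of_real (B * (cmod (x N))\<^sup>2)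
      + (C * x 1 * cnj (x N) + cnj (C * x 1 * cnj (x N)))"
    unfolding H_def of_real_mult complex_norm_square by (simp add: algebra_simps)
  then show ?thesis by (simp only: plus_complex.sel Re_complex_of_real cnj.sel mult_2)
qed

lemma cmod_diff_sq: "(cmod (u - v))\<^sup>2 = (cmod u)\<^sup>2 + (cmod v)\<^sup>2 - 2 * Re (u * cnj v)"
  unfolding cmod_power2 by (simp add: power2_eq_square algebra_simps)

lemma Re_of_real_mult: "Re (of_real r * u) = r * Re u"
  by simp

text \<open>The Schur complement of \<open>b22\<close> is \<open>D / b22\<close>, which is the
  denominator here; the functional in the square is the one that defines the hyperplane of
  \<open>bcA_singular_b\<close>.\<close>

lemma bcA_square_b:
  fixes a11 b22 :: real and z :: complex
  defines "D \<equiv> b22 * (a11 + f 0) - (cmod z)\<^sup>2"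
  assumes D: "D \<noteq> 0" and b: "b22 \<noteq> 0"
  shows "Re (H (- ((f 0)\<^sup>2 * b22) / D) (- (a11 + f 0) / D) (of_real (f 0 / D) * z) x x)
    = Re (H 0 (- 1 / b22) 0 x x)
      - (cmod (of_real (f 0) * x 1 + - cnj z / of_real b22 * x N))\<^sup>2 / (a11 - ((cmod z)\<^sup>2 / b22 - f 0))"
proof -
  define P Q T S where "P = (cmod (x 1))\<^sup>2" and "Q = (cmod (x N))\<^sup>2" and "T = Re (z * x 1 * cnj (x N))"
    and "S = (cmod z)\<^sup>2"
  let ?u = "of_real (f 0) * x 1" and ?v = "cnj z / of_real b22 * x N"
  have "?u * cnj ?v = of_real (f 0 / b22) * (z * x 1 * cnj (x N))"
    by (simp add: algebra_simps)
  then have T: "Re (?u * cnj ?v) = f 0 / b22 * T"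
    unfolding T_def by (simp only: Re_of_real_mult)
  have PQ: "(cmod ?u)\<^sup>2 = (f 0)\<^sup>2 * P" "(cmod ?v)\<^sup>2 = S / b22\<^sup>2 * Q"
    by (simp_all add: P_def Q_def S_def norm_mult norm_divide power_mult_distrib power_divide)
  have "(cmod (?u - ?v))\<^sup>2 = (f 0)\<^sup>2 * P + S / b22\<^sup>2 * Q - 2 * (f 0 / b22 * T)"
    unfolding cmod_diff_sq T PQ ..
  also have "?u - ?v = ?u + - cnj z / of_real b22 * x N" by simp
  finally have sq: "(cmod (?u + - cnj z / of_real b22 * x N))\<^sup>2
      = (f 0)\<^sup>2 * P + S / b22\<^sup>2 * Q - 2 * (f 0 / b22 * T)" .
  have cr: "Re (of_real (f 0 / D) * z * x 1 * cnj (x N)) = f 0 / D * T"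
    unfolding T_def mult.assoc Re_of_real_mult ..
  have den: "a11 - (S / b22 - f 0) = D / b22" using b by (simp add: D_def S_def field_simps)
  \<comment> \<open>Replacing |z|^2 by \<open>D\<close> leaves a rational identity with the nonzero
    denominators \<open>D\<close> and \<open>b22\<close>.\<close>
  have SD: "S = b22 * (a11 + f 0) - D" by (simp add: D_def S_def)
  show ?thesis unfolding Re_H sq cr P_def[symmetric] Q_def[symmetric] S_def[symmetric] den
    using D b by (simp add: SD field_simps power2_eq_square)
qed

lemma bcA_square_a:
  fixes a11 b22 :: real and z :: complex
  defines "D \<equiv> b22 * (a11 + f 0) - (cmod z)\<^sup>2"
  assumes D: "D \<noteq> 0" and a: "a11 + f 0 \<noteq> 0"
  shows "Re (H (- ((f 0)\<^sup>2 * b22) / D) (- (a11 + f 0) / D) (of_real (f 0 / D) * z) x x)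
    = Re (H (- (f 0)\<^sup>2 / (a11 + f 0)) 0 0 x x)
      - (cmod (- z * of_real (f 0) / of_real (a11 + f 0) * x 1 + 1 * x N))\<^sup>2 / (b22 - (cmod z)\<^sup>2 / (a11 + f 0))"
proof -
  define P Q T S where "P = (cmod (x 1))\<^sup>2" and "Q = (cmod (x N))\<^sup>2" and "T = Re (z * x 1 * cnj (x N))"
    and "S = (cmod z)\<^sup>2"
  define \<alpha> where "\<alpha> = a11 + f 0"
  let ?u = "z * of_real (f 0) / of_real \<alpha> * x 1"
  have "?u * cnj (x N) = of_real (f 0 / \<alpha>) * (z * x 1 * cnj (x N))"
    by (simp add: algebra_simps)
  then have T: "Re (?u * cnj (x N)) = f 0 / \<alpha> * T"
    unfolding T_def by (simp only: Re_of_real_mult)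
  have PQ: "(cmod ?u)\<^sup>2 = S * (f 0)\<^sup>2 / \<alpha>\<^sup>2 * P"
    by (simp add: P_def S_def norm_mult norm_divide power_mult_distrib power_divide)
  have "(cmod (?u - x N))\<^sup>2 = S * (f 0)\<^sup>2 / \<alpha>\<^sup>2 * P + Q - 2 * (f 0 / \<alpha> * T)"
    unfolding cmod_diff_sq T PQ Q_def ..
  also have "cmod (?u - x N) = cmod (- z * of_real (f 0) / of_real \<alpha> * x 1 + 1 * x N)"
    by (subst norm_minus_commute) simp
  finally have sq: "(cmod (- z * of_real (f 0) / of_real \<alpha> * x 1 + 1 * x N))\<^sup>2
      = S * (f 0)\<^sup>2 / \<alpha>\<^sup>2 * P + Q - 2 * (f 0 / \<alpha> * T)" .
  have cr: "Re (of_real (f 0 / D) * z * x 1 * cnj (x N)) = f 0 / D * T"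
    unfolding T_def mult.assoc Re_of_real_mult ..
  have den: "b22 - S / \<alpha> = D / \<alpha>" using a by (simp add: D_def S_def \<alpha>_def field_simps)
  have SD: "S = b22 * \<alpha> - D" by (simp add: D_def S_def \<alpha>_def)
  have a': "\<alpha> \<noteq> 0" using a by (simp add: \<alpha>_def)
  show ?thesis unfolding \<alpha>_def[symmetric] Re_H sq cr P_def[symmetric] Q_def[symmetric] S_def[symmetric] den
    using D a' by (simp add: SD field_simps power2_eq_square)
qed


section \<open>Interlacing of the eigenvalues\<close>

lemma sl_ev_X_mono:
  assumes "represents M1 X h1 N" "represents M2 X h2 N" "\<And>x. Re (h1 x x) \<le> Re (h2 x x)" "n \<le> N - 1"
  shows "sl_ev f q w N M1 n \<le> sl_ev f q w N M2 n"
  using sl_ev_mono[OF assms(1,2) subset_refl assms(3), of n] assms(4) N2 by simp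

text \<open>Cauchy interlacing for a hyperplane on which the two forms agree. The constrained
  problem has \<open>N - 1\<close> eigenvalues, so its last index is \<open>N - 2\<close>.\<close>

lemma sl_ev_K_interlace:
  assumes r: "represents M X h N" and k: "represents M' (K a b) h' (N - 1)"
    and eq: "\<And>x. a * x 1 + b * x N = 0 \<Longrightarrow> Re (h x x) = Re (h' x x)" and n: "n \<le> N - 2"
  shows "sl_ev f q w N M n \<le> sl_ev f q w N M' n"
    and "sl_ev f q w N M' n \<le> sl_ev f q w N M (n + 1)"
proof -
  have KX: "K a b \<subseteq> X" by (auto simp: K_def)
  have e: "Re (h x x) = Re (h' x x)" if "x \<in> K a b" for x using eq[of x] that by (simp add: K_def)
  show "sl_ev f q w N M n \<le> sl_ev f q w N M' n"
    by (rule sl_ev_mono[OF r k KX]) (use e n N2 in auto)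
  show "sl_ev f q w N M' n \<le> sl_ev f q w N M (n + 1)"
    by (rule sl_ev_mono_Suc[OF k r]) (use e n N2 in auto)
qed

text \<open>For the families without a pole: if \<open>b22\<close> or \<open>a11 + f 0\<close> is 0,
  the determinant is -|z|^2 whatever the other parameter, so the whole family lives on
  \<open>X\<close> and only S_5 or S_6 is constrained.\<close>

lemma interlace_bounded:
  fixes h :: "real \<Rightarrow> (nat \<Rightarrow> complex) \<Rightarrow> (nat \<Rightarrow> complex) \<Rightarrow> complex"
  assumes r: "\<And>s. represents (M s) X (h s) N" and k: "represents M' (K a b) h' (N - 1)"
    and mono: "\<And>s s' x. s < s' \<Longrightarrow> Re (h s x x) \<le> Re (h s' x x)"
    and eq: "\<And>s x. a * x 1 + b * x N = 0 \<Longrightarrow> Re (h s x x) = Re (h' x x)" and s: "s1 < s2"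
  shows "(\<forall>n\<le>N-2. sl_ev f q w N (M s1) n \<le> sl_ev f q w N (M s2) n
        \<and> sl_ev f q w N (M s2) n \<le> sl_ev f q w N M' n
        \<and> sl_ev f q w N M' n \<le> sl_ev f q w N (M s1) (n+1))
      \<and> sl_ev f q w N (M s1) (N-1) \<le> sl_ev f q w N (M s2) (N-1)"
proof -
  have m: "sl_ev f q w N (M s1) n \<le> sl_ev f q w N (M s2) n" if "n \<le> N - 1" for n
    by (rule sl_ev_X_mono[OF r r mono[OF s] that])
  show ?thesis
  proof (intro conjI allI impI m)
    fix n assume n: "n \<le> N - 2"
    show "n \<le> N - 1" using n by simp
    show "sl_ev f q w N (M s2) n \<le> sl_ev f q w N M' n"
      by (rule sl_ev_K_interlace(1)[OF r k eq n])
    show "sl_ev f q w N M' n \<le> sl_ev f q w N (M s1) (n + 1)"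
      by (rule sl_ev_K_interlace(2)[OF r k eq n])
  qed simp
qed

text \<open>The coupling \<open>- 1 / (s - \<sigma>)\<close> increases from 0 to infinity on \<open>s < \<sigma>\<close> and from minus infinity to 0 on
  \<open>s > \<sigma>\<close>; at \<open>s = \<sigma>\<close> it degenerates into the constraint, at \<open>s = \<infinity>\<close> the perturbation disappears.\<close>

lemma interlace_pole:
  fixes h :: "real \<Rightarrow> (nat \<Rightarrow> complex) \<Rightarrow> (nat \<Rightarrow> complex) \<Rightarrow> complex"
  assumes r: "\<And>s. s \<noteq> \<sigma> \<Longrightarrow> represents (M s) X (h s) N" and k: "represents (M \<sigma>) (K a b) h' (N - 1)"
    and r': "represents M' X h' N"
    and eq: "\<And>s x. s \<noteq> \<sigma> \<Longrightarrow> Re (h s x x) = Re (h' x x) - (cmod (a * x 1 + b * x N))\<^sup>2 / (s - \<sigma>)"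
    and s: "s1 < s2" "s2 \<le> \<sigma>" "\<sigma> < s3" "s3 < s4"
  shows "(\<forall>n\<le>N-1. sl_ev f q w N (M s3) n \<le> sl_ev f q w N (M s4) n
          \<and> sl_ev f q w N (M s4) n \<le> sl_ev f q w N M' n
          \<and> sl_ev f q w N M' n \<le> sl_ev f q w N (M s1) n)
      \<and> (\<forall>n\<le>N-2. sl_ev f q w N (M s1) n \<le> sl_ev f q w N (M s2) n
          \<and> sl_ev f q w N (M s2) n \<le> sl_ev f q w N (M s3) (n+1))
      \<and> (s2 < \<sigma> \<longrightarrow> sl_ev f q w N (M s1) (N-1) \<le> sl_ev f q w N (M s2) (N-1))"
proof -
  have same: "sl_ev f q w N (M s) n \<le> sl_ev f q w N (M s') n"
    if "s < s'" "s' < \<sigma> \<or> \<sigma> < s" "n \<le> N - 1" for s s' n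
  proof (rule sl_ev_X_mono[OF r[of s] r[of s'] _ that(3)])
    show ne: "s \<noteq> \<sigma>" "s' \<noteq> \<sigma>" using that by auto
    fix x
    have "1 / (s' - \<sigma>) \<le> 1 / (s - \<sigma>)"
      using that(1,2) by (intro divide_left_mono) (auto simp: mult_neg_neg)
    from mult_left_mono[OF this, of "(cmod (a * x 1 + b * x N))\<^sup>2"]
    show "Re (h s x x) \<le> Re (h s' x x)" unfolding eq[OF ne(1)] eq[OF ne(2)] by simp
  qed
  have below: "sl_ev f q w N M' n \<le> sl_ev f q w N (M s) n" if "s < \<sigma>" "n \<le> N - 1" for s n
  proof (rule sl_ev_X_mono[OF r' r[of s] _ that(2)])
    show ne: "s \<noteq> \<sigma>" using that by simp
    show "Re (h' x x) \<le> Re (h s x x)" for x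
      unfolding eq[OF ne] using that(1) by (simp add: divide_nonneg_neg)
  qed
  have above: "sl_ev f q w N (M s) n \<le> sl_ev f q w N M' n" if "\<sigma> < s" "n \<le> N - 1" for s n
  proof (rule sl_ev_X_mono[OF r[of s] r' _ that(2)])
    show ne: "s \<noteq> \<sigma>" using that by simp
    show "Re (h s x x) \<le> Re (h' x x)" for x
      unfolding eq[OF ne] using that(1) by simp
  qed
  have pole: "sl_ev f q w N (M s) n \<le> sl_ev f q w N (M \<sigma>) n"
    "sl_ev f q w N (M \<sigma>) n \<le> sl_ev f q w N (M s) (n + 1)" if "s \<noteq> \<sigma>" "n \<le> N - 2" for s n
  proof -
    have e: "Re (h s x x) = Re (h' x x)" if "a * x 1 + b * x N = 0" for x
      unfolding eq[OF \<open>s \<noteq> \<sigma>\<close>] that by simp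
    show "sl_ev f q w N (M s) n \<le> sl_ev f q w N (M \<sigma>) n"
      by (rule sl_ev_K_interlace(1)[OF r[OF that(1)] k e that(2)])
    show "sl_ev f q w N (M \<sigma>) n \<le> sl_ev f q w N (M s) (n + 1)"
      by (rule sl_ev_K_interlace(2)[OF r[OF that(1)] k e that(2)])
  qed
  have "sl_ev f q w N (M s1) n \<le> sl_ev f q w N (M s2) n \<and> sl_ev f q w N (M s2) n \<le> sl_ev f q w N (M s3) (n+1)"
    if n: "n \<le> N - 2" for n
  proof
    have n': "n \<le> N - 1" using n by simp
    show "sl_ev f q w N (M s1) n \<le> sl_ev f q w N (M s2) n"
      \<comment> \<open>At \<open>s2 = \<sigma>\<close> the second problem lives on the hyperplane
        and monotonicity of the coupling gives way to interlacing. That problem has no eigenvalue of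
        index \<open>N - 1\<close>, hence the separate last claim for
        \<open>s2 < \<sigma>\<close>.\<close>
      using same[OF s(1) _ n'] pole(1)[OF _ n, of s1] s by (cases "s2 = \<sigma>") auto
    \<comment> \<open>Passing from below the pole to above it goes through the constrained problem
      at \<open>\<sigma>\<close>, and this is where the index moves up by one.\<close>
    have "sl_ev f q w N (M s2) n \<le> sl_ev f q w N (M \<sigma>) n"
      using pole(1)[OF _ n, of s2] by (cases "s2 = \<sigma>") auto
    also have "\<dots> \<le> sl_ev f q w N (M s3) (n + 1)" using pole(2)[OF _ n, of s3] s by auto
    finally show "sl_ev f q w N (M s2) n \<le> sl_ev f q w N (M s3) (n+1)" .
  qed
  moreover have "sl_ev f q w N (M s3) n \<le> sl_ev f q w N (M s4) n" "sl_ev f q w N (M s4) n \<le> sl_ev f q w N M' n"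
    "sl_ev f q w N M' n \<le> sl_ev f q w N (M s1) n" if "n \<le> N - 1" for n
    using same[OF s(4) _ that] above[OF _ that, of s4] below[OF _ that, of s1] s by auto
  ultimately show ?thesis using same[OF s(1), of "N - 1"] by blast
qed

lemma interlace_a_bounded:
  assumes z: "z \<noteq> 0" and x: "x1 < x2"
  shows "(\<forall>n\<le>N-2. sl_ev f q w N (bcA z x1 0) n \<le> sl_ev f q w N (bcA z x2 0) n
        \<and> sl_ev f q w N (bcA z x2 0) n \<le> sl_ev f q w N (bcS5 0) n
        \<and> sl_ev f q w N (bcS5 0) n \<le> sl_ev f q w N (bcA z x1 0) (n+1))
      \<and> sl_ev f q w N (bcA z x1 0) (N-1) \<le> sl_ev f q w N (bcA z x2 0) (N-1)"
proof (rule interlace_bounded[of "\<lambda>s. bcA z s 0", OF _ S5_singular _ _ x])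
  \<comment> \<open>The form of \<open>bcA_regular\<close> at \<open>b22 = 0\<close>:
    \<open>s\<close> only scales |x_N|^2, and every boundary term vanishes under the constraint
    \<open>x N = 0\<close> of S_5.\<close>
  let ?h = "\<lambda>s. H 0 ((s + f 0) / (cmod z)\<^sup>2) (of_real (- f 0 / (cmod z)\<^sup>2) * z)"
  show "represents (bcA z s 0) X (?h s) N" for s
  proof -
    have "- ((f 0)\<^sup>2 * 0) / (0 * (s + f 0) - (cmod z)\<^sup>2) = 0"
      "- (s + f 0) / (0 * (s + f 0) - (cmod z)\<^sup>2) = (s + f 0) / (cmod z)\<^sup>2"
      "f 0 / (0 * (s + f 0) - (cmod z)\<^sup>2) = - f 0 / (cmod z)\<^sup>2"
      using z by (simp_all add: field_simps)
    note e = this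
    show ?thesis by (rule bcA_regular[of 0 s z, unfolded e]) (use z in simp)
  qed
  show "Re (?h s x x) \<le> Re (?h s' x x)" if "s < s'" for s s' x
    unfolding Re_H using that by (simp add: mult_right_mono divide_right_mono)
  show "Re (?h s x x) = Re (H 0 0 0 x x)" if "0 * x 1 + 1 * x N = 0" for s x
    unfolding Re_H using that by simp
qed

lemma interlace_b_bounded:
  assumes a: "a11 + f 0 = 0" and z: "z \<noteq> 0" and y: "y1 < y2"
  shows "(\<forall>n\<le>N-2. sl_ev f q w N (bcA z a11 y1) n \<le> sl_ev f q w N (bcA z a11 y2) n
        \<and> sl_ev f q w N (bcA z a11 y2) n \<le> sl_ev f q w N (bcS6 a11) n
        \<and> sl_ev f q w N (bcS6 a11) n \<le> sl_ev f q w N (bcA z a11 y1) (n+1))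
      \<and> sl_ev f q w N (bcA z a11 y1) (N-1) \<le> sl_ev f q w N (bcA z a11 y2) (N-1)"
proof (rule interlace_bounded[of "\<lambda>s. bcA z a11 s", OF _ S6_singular[OF a] _ _ y])
  \<comment> \<open>Here \<open>s\<close> only scales |x_1|^2, and the constraint of S_6 is
    \<open>x 1 = 0\<close>.\<close>
  let ?h = "\<lambda>s. H ((f 0)\<^sup>2 * s / (cmod z)\<^sup>2) 0 (of_real (- f 0 / (cmod z)\<^sup>2) * z)"
  show "represents (bcA z a11 s) X (?h s) N" for s
  proof -
    have "- ((f 0)\<^sup>2 * s) / (s * 0 - (cmod z)\<^sup>2) = (f 0)\<^sup>2 * s / (cmod z)\<^sup>2"
      "- 0 / (s * 0 - (cmod z)\<^sup>2) = 0"
      "f 0 / (s * 0 - (cmod z)\<^sup>2) = - f 0 / (cmod z)\<^sup>2"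
      using z by (simp_all add: field_simps)
    note e = this
    show ?thesis by (rule bcA_regular[of s a11 z, unfolded a e]) (use z in simp)
  qed
  show "Re (?h s x x) \<le> Re (?h s' x x)" if "s < s'" for s s' x
    unfolding Re_H using that by (simp add: mult_right_mono mult_left_mono divide_right_mono)
  show "Re (?h s x x) = Re (H 0 0 0 x x)" if "of_real (f 0) * x 1 + 0 * x N = 0" for s x
    unfolding Re_H using that f_nz[of 0] by simp
qed

lemma interlace_a_pole:
  assumes b: "b22 \<noteq> 0" and z: "z \<noteq> 0"
    and x: "x1 < x2" "x2 \<le> (cmod z)\<^sup>2 / b22 - f 0" "(cmod z)\<^sup>2 / b22 - f 0 < x3" "x3 < x4"
  shows "(\<forall>n\<le>N-1. sl_ev f q w N (bcA z x3 b22) n \<le> sl_ev f q w N (bcA z x4 b22) n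
          \<and> sl_ev f q w N (bcA z x4 b22) n \<le> sl_ev f q w N (bcS5 b22) n
          \<and> sl_ev f q w N (bcS5 b22) n \<le> sl_ev f q w N (bcA z x1 b22) n)
      \<and> (\<forall>n\<le>N-2. sl_ev f q w N (bcA z x1 b22) n \<le> sl_ev f q w N (bcA z x2 b22) n
          \<and> sl_ev f q w N (bcA z x2 b22) n \<le> sl_ev f q w N (bcA z x3 b22) (n+1))
      \<and> (x2 < (cmod z)\<^sup>2 / b22 - f 0 \<longrightarrow>
            sl_ev f q w N (bcA z x1 b22) (N-1) \<le> sl_ev f q w N (bcA z x2 b22) (N-1))"
proof (rule interlace_pole[of _ "\<lambda>s. bcA z s b22", OF bcA_regular bcA_singular_b S5_regular[OF b] bcA_square_b x])
  have "s = (cmod z)\<^sup>2 / b22 - f 0 \<longleftrightarrow> b22 * (s + f 0) = (cmod z)\<^sup>2" for s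
    using b by (auto simp: field_simps)
  \<comment> \<open>The nonzero determinant is required twice, by \<open>bcA_regular\<close> and by
    \<open>bcA_square_b\<close>.\<close>
  then show "s \<noteq> (cmod z)\<^sup>2 / b22 - f 0 \<Longrightarrow> b22 * (s + f 0) - (cmod z)\<^sup>2 \<noteq> 0"
    and "s \<noteq> (cmod z)\<^sup>2 / b22 - f 0 \<Longrightarrow> b22 * (s + f 0) - (cmod z)\<^sup>2 \<noteq> 0"
    and "b22 * ((cmod z)\<^sup>2 / b22 - f 0 + f 0) = (cmod z)\<^sup>2" for s using b by auto
qed (use b z in auto)

lemma interlace_b_pole:
  assumes a: "a11 + f 0 \<noteq> 0" and z: "z \<noteq> 0"
    and y: "y1 < y2" "y2 \<le> (cmod z)\<^sup>2 / (a11 + f 0)" "(cmod z)\<^sup>2 / (a11 + f 0) < y3" "y3 < y4"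
  shows "(\<forall>n\<le>N-1. sl_ev f q w N (bcA z a11 y3) n \<le> sl_ev f q w N (bcA z a11 y4) n
          \<and> sl_ev f q w N (bcA z a11 y4) n \<le> sl_ev f q w N (bcS6 a11) n
          \<and> sl_ev f q w N (bcS6 a11) n \<le> sl_ev f q w N (bcA z a11 y1) n)
      \<and> (\<forall>n\<le>N-2. sl_ev f q w N (bcA z a11 y1) n \<le> sl_ev f q w N (bcA z a11 y2) n
          \<and> sl_ev f q w N (bcA z a11 y2) n \<le> sl_ev f q w N (bcA z a11 y3) (n+1))
      \<and> (y2 < (cmod z)\<^sup>2 / (a11 + f 0) \<longrightarrow>
            sl_ev f q w N (bcA z a11 y1) (N-1) \<le> sl_ev f q w N (bcA z a11 y2) (N-1))"
proof (rule interlace_pole[of _ "\<lambda>s. bcA z a11 s", OF bcA_regular bcA_singular_a S6_regular[OF a] bcA_square_a y])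
  have "s = (cmod z)\<^sup>2 / (a11 + f 0) \<longleftrightarrow> s * (a11 + f 0) = (cmod z)\<^sup>2" for s
    using a by (auto simp: eq_divide_eq)
  then show "s \<noteq> (cmod z)\<^sup>2 / (a11 + f 0) \<Longrightarrow> s * (a11 + f 0) - (cmod z)\<^sup>2 \<noteq> 0"
    and "s \<noteq> (cmod z)\<^sup>2 / (a11 + f 0) \<Longrightarrow> s * (a11 + f 0) - (cmod z)\<^sup>2 \<noteq> 0"
    and "(cmod z)\<^sup>2 / (a11 + f 0) * (a11 + f 0) = (cmod z)\<^sup>2" for s by auto
qed (use a z in auto)

end

theorem theorem3p4:
  fixes f q w :: "nat \<Rightarrow> real" and N :: nat and z :: complex and a11 b22 :: real
  assumes N2: "N \<ge> 2"
    and f_nz: "\<And>n. n \<le> N \<Longrightarrow> f n \<noteq> 0"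
    and w_pos: "\<And>n. 1 \<le> n \<Longrightarrow> n \<le> N \<Longrightarrow> w n > 0"
    and z_nz: "z \<noteq> 0"
  shows
    "sl_num f q w N (bcA z a11 b22) = (if b22 * (a11 + f 0) \<noteq> (cmod z)^2 then N else N - 1)
   \<and> sl_num f q w N (bcS5 b22) = (if b22 \<noteq> 0 then N else N - 1)
   \<and> sl_num f q w N (bcS6 a11) = (if a11 + f 0 \<noteq> 0 then N else N - 1)
   \<and> (b22 = 0 \<longrightarrow> (\<forall>x1 x2. x1 < x2 \<longrightarrow>
        (\<forall>n\<le>N-2.
            sl_ev f q w N (bcA z x1 b22) n \<le> sl_ev f q w N (bcA z x2 b22) n
          \<and> sl_ev f q w N (bcA z x2 b22) n \<le> sl_ev f q w N (bcS5 b22) n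
          \<and> sl_ev f q w N (bcS5 b22) n \<le> sl_ev f q w N (bcA z x1 b22) (n+1))
      \<and> sl_ev f q w N (bcA z x1 b22) (N-1) \<le> sl_ev f q w N (bcA z x2 b22) (N-1)))
   \<and> (b22 \<noteq> 0 \<longrightarrow> (\<forall>x1 x2 x3 x4.
        x1 < x2 \<and> x2 \<le> (cmod z)^2 / b22 - f 0 \<and> (cmod z)^2 / b22 - f 0 < x3 \<and> x3 < x4 \<longrightarrow>
        (\<forall>n\<le>N-1.
            sl_ev f q w N (bcA z x3 b22) n \<le> sl_ev f q w N (bcA z x4 b22) n
          \<and> sl_ev f q w N (bcA z x4 b22) n \<le> sl_ev f q w N (bcS5 b22) n
          \<and> sl_ev f q w N (bcS5 b22) n \<le> sl_ev f q w N (bcA z x1 b22) n)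
      \<and> (\<forall>n\<le>N-2.
            sl_ev f q w N (bcA z x1 b22) n \<le> sl_ev f q w N (bcA z x2 b22) n
          \<and> sl_ev f q w N (bcA z x2 b22) n \<le> sl_ev f q w N (bcA z x3 b22) (n+1))
      \<and> (x2 < (cmod z)^2 / b22 - f 0 \<longrightarrow>
            sl_ev f q w N (bcA z x1 b22) (N-1) \<le> sl_ev f q w N (bcA z x2 b22) (N-1))))
   \<and> (a11 + f 0 = 0 \<longrightarrow> (\<forall>y1 y2. y1 < y2 \<longrightarrow>
        (\<forall>n\<le>N-2.
            sl_ev f q w N (bcA z a11 y1) n \<le> sl_ev f q w N (bcA z a11 y2) n
          \<and> sl_ev f q w N (bcA z a11 y2) n \<le> sl_ev f q w N (bcS6 a11) n
          \<and> sl_ev f q w N (bcS6 a11) n \<le> sl_ev f q w N (bcA z a11 y1) (n+1))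
      \<and> sl_ev f q w N (bcA z a11 y1) (N-1) \<le> sl_ev f q w N (bcA z a11 y2) (N-1)))
   \<and> (a11 + f 0 \<noteq> 0 \<longrightarrow> (\<forall>y1 y2 y3 y4.
        y1 < y2 \<and> y2 \<le> (cmod z)^2 / (a11 + f 0) \<and> (cmod z)^2 / (a11 + f 0) < y3 \<and> y3 < y4 \<longrightarrow>
        (\<forall>n\<le>N-1.
            sl_ev f q w N (bcA z a11 y3) n \<le> sl_ev f q w N (bcA z a11 y4) n
          \<and> sl_ev f q w N (bcA z a11 y4) n \<le> sl_ev f q w N (bcS6 a11) n
          \<and> sl_ev f q w N (bcS6 a11) n \<le> sl_ev f q w N (bcA z a11 y1) n)
      \<and> (\<forall>n\<le>N-2.
            sl_ev f q w N (bcA z a11 y1) n \<le> sl_ev f q w N (bcA z a11 y2) n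
          \<and> sl_ev f q w N (bcA z a11 y2) n \<le> sl_ev f q w N (bcA z a11 y3) (n+1))
      \<and> (y2 < (cmod z)^2 / (a11 + f 0) \<longrightarrow>
            sl_ev f q w N (bcA z a11 y1) (N-1) \<le> sl_ev f q w N (bcA z a11 y2) (N-1))))"
proof -
  interpret sl_equation f q w N using assms(1-3) by unfold_locales
  have n1: "sl_num f q w N (bcA z a11 b22) = (if b22 * (a11 + f 0) \<noteq> (cmod z)^2 then N else N - 1)"
    using sl_num_represents[OF bcA_regular, of b22 a11 z] sl_num_represents[OF bcA_singular_b, of b22 a11 z] z_nz
    by auto
  have n2: "sl_num f q w N (bcS5 b22) = (if b22 \<noteq> 0 then N else N - 1)"
    using sl_num_represents[OF S5_regular, of b22] sl_num_represents[OF S5_singular] by auto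
  have n3: "sl_num f q w N (bcS6 a11) = (if a11 + f 0 \<noteq> 0 then N else N - 1)"
    using sl_num_represents[OF S6_regular, of a11] sl_num_represents[OF S6_singular, of a11] by auto
  show ?thesis
  proof (rule conjI[OF n1 conjI[OF n2 conjI[OF n3]]], 
      (rule conjI[OF _ conjI[OF _ conjI]]; intro impI allI), goal_cases)
    case (1 x1 x2)
    show ?case unfolding 1(1) by (rule interlace_a_bounded[OF z_nz 1(2)])
  next
    case (2 x1 x2 x3 x4)
    then have "x1 < x2" "x2 \<le> (cmod z)^2 / b22 - f 0" "(cmod z)^2 / b22 - f 0 < x3" "x3 < x4" by simp_all
    then show ?case by (rule interlace_a_pole[OF 2(1) z_nz])
  next
    case (3 y1 y2)
    show ?case by (rule interlace_b_bounded[OF 3(1) z_nz 3(2)])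
  next
    case (4 y1 y2 y3 y4)
    then have "y1 < y2" "y2 \<le> (cmod z)^2 / (a11 + f 0)" "(cmod z)^2 / (a11 + f 0) < y3" "y3 < y4" by simp_all
    then show ?case by (rule interlace_b_pole[OF 4(1) z_nz])
  qed
qed

end
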